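(* Let $\mathcal{C}$ be a completion-post-effective, $\infty$-completion-effective and positive-effective class of positive very-WSTS. Then the repeated coverability problem is decidable for $\mathcal{C}$: given $\mathcal{S}=(X,\xrightarrow{\Sigma},\le)\in\mathcal{C}$ and $x,y\in X$, one can decide whether $y$ is repeatedly coverable from $x$.
   Context: A (labeled, ordered) transition system is $\mathcal{S}=(X,\xrightarrow{\Sigma},\le)$: $X$ a set, $\Sigma$ a finite alphabet, $\xrightarrow{a}\subseteq X\times X$, $\le$ a quasi-ordering; relations extend to words. $\mathrm{Post}(x,w)=\{y:x\xrightarrow{w}y\}$, extended to sets by union; $\downarrow D=\{x:\exists y\in D,\,x\le y\}$. WSTS: $\le$ a wqo and $x\xrightarrow{a}y$, $x'\ge x$ imply $x'\xrightarrow{w}y'\ge y$ for some $w$. Strong monotonicity: $x\xrightarrow{a}y$, $x'\ge x$ imply $x'\xrightarrow{a}y'$ with $y'\ge y$; strong-strict: additionally $x'>x$ gives $y'>y$. Deterministic: at most one $a$-successor. Ideals: nonempty downward-closed directed subsets, set $\mathrm{Idl}(X)$. Completion $\widehat{\mathcal{S}}=(\mathrm{Idl}(X),\Rightarrow_\Sigma,\subseteq)$ with $I\xRightarrow{a}J$ iff $J$ is a $\subseteq$-maximal ideal included in $\downarrow\mathrm{Post}(I,a)$; if deterministic, $w(I)$ is the unique $J$ with $I\xRightarrow{w}J$. $w^\infty(I)=\bigcup_kw^k(I)$ if $I\subset w(I)$, else $I$. Levels: $\mathrm{Idl}_0(X)=\mathrm{Idl}(X)$, $\mathrm{Idl}_n(X)$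 = unions of strictly increasing sequences in $\mathrm{Idl}_{n-1}(X)$; finitely many levels if some $\mathrm{Idl}_n(X)=\emptyset$. Very-WSTS: WSTS with strong monotonicity whose completion is a deterministic WSTS ($\subseteq$ a wqo on ideals) with strong-strict monotonicity, and $\mathrm{Idl}(X)$ has finitely many levels. Positivity: $w$ is positive for $x$ if $x\xrightarrow{w}z$ for some $z\ge x$; $w$ is positive if positive for every $x$ with $\mathrm{Post}(x,w)\ne\emptyset$; $\mathcal{S}$ is positive if every word positive for some state is positive. $y$ is repeatedly coverable from $x$ if there are $z_0,z_1,\dots$ with $x\xrightarrow{*}z_0\xrightarrow{+}z_1\xrightarrow{+}\cdots$ and $z_i\ge y$ for all $i$. Effectiveness: a class is completion-post-effective if ideals can be effectively represented and manipulated, inclusion of ideals is decidable, and the completion successors of any ideal are computable; $\infty$-completion-effective if $w^\infty(I)$ is computable for every ideal $I$ and word $w$; positive-effective if there is an algorithm deciding, given $\mathcal{S}\in\mathcal{C}$ and a finite automaton $A$ over $\Sigma$, whether the language of $A$ contains a positive word. *)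

theory Defs
  imports Main "HOL-Library.Nat_Bijection"
begin

datatype recf = Zero | Succ | Proj nat | Comp recf "recf list" | PRec recf recf | MinR recf

inductive evalr :: "recf \<Rightarrow> nat list \<Rightarrow> nat \<Rightarrow> bool" where
  ev_zero: "evalr Zero xs 0"
| ev_succ: "evalr Succ (x # xs) (Suc x)"
| ev_proj: "i < length xs \<Longrightarrow> evalr (Proj i) xs (xs ! i)"
| ev_comp: "length ys = length gs \<Longrightarrow> (\<forall>i < length gs. evalr (gs ! i) xs (ys ! i))
            \<Longrightarrow> evalr f ys z \<Longrightarrow> evalr (Comp f gs) xs z"
| ev_prec0: "evalr f xs y \<Longrightarrow> evalr (PRec f g) (0 # xs) y"
| ev_precS: "evalr (PRec f g) (n # xs) y \<Longrightarrow> evalr g (y # n # xs) z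
            \<Longrightarrow> evalr (PRec f g) (Suc n # xs) z"
| ev_min: "evalr f (n # xs) 0 \<Longrightarrow> (\<forall>m < n. \<exists>k. k \<noteq> 0 \<and> evalr f (m # xs) k)
            \<Longrightarrow> evalr (MinR f) xs n"

definition computes_on :: "recf \<Rightarrow> nat list set \<Rightarrow> (nat list \<Rightarrow> nat \<Rightarrow> bool) \<Rightarrow> bool" where
  "computes_on p D Q \<longleftrightarrow> (\<forall>xs\<in>D. (\<exists>r. evalr p xs r) \<and> (\<forall>r. evalr p xs r \<longrightarrow> Q xs r))"

definition decides_on :: "recf \<Rightarrow> nat list set \<Rightarrow> (nat list \<Rightarrow> bool) \<Rightarrow> bool" where
  "decides_on p D P \<longleftrightarrow> computes_on p D (\<lambda>xs r. r = (if P xs then 1 else 0))"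

record 'x ts =
  states :: "'x set"
  alph :: "nat set"
  step :: "nat \<Rightarrow> 'x \<Rightarrow> 'x \<Rightarrow> bool"
  ord :: "'x \<Rightarrow> 'x \<Rightarrow> bool"

definition ts_wf :: "'x ts \<Rightarrow> bool" where
  "ts_wf S \<longleftrightarrow> finite (alph S) \<and>
     (\<forall>a x y. step S a x y \<longrightarrow> a \<in> alph S \<and> x \<in> states S \<and> y \<in> states S)"

inductive steps :: "'x ts \<Rightarrow> nat list \<Rightarrow> 'x \<Rightarrow> 'x \<Rightarrow> bool" for S where
  steps_nil: "x \<in> states S \<Longrightarrow> steps S [] x x"
| steps_cons: "step S a x y \<Longrightarrow> steps S w y z \<Longrightarrow> steps S (a # w) x z"

definition Post :: "'x ts \<Rightarrow> 'x \<Rightarrow> nat list \<Rightarrow> 'x set" where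
  "Post S x w = {y. steps S w x y}"

definition PostSet :: "'x ts \<Rightarrow> 'x set \<Rightarrow> nat list \<Rightarrow> 'x set" where
  "PostSet S D w = (\<Union>x\<in>D. Post S x w)"

definition down :: "'x ts \<Rightarrow> 'x set \<Rightarrow> 'x set" where
  "down S D = {x \<in> states S. \<exists>y\<in>D. ord S x y}"

definition less_ts :: "'x ts \<Rightarrow> 'x \<Rightarrow> 'x \<Rightarrow> bool" where
  "less_ts S x y \<longleftrightarrow> ord S x y \<and> \<not> ord S y x"

definition quasi_order_on :: "'x ts \<Rightarrow> bool" where
  "quasi_order_on S \<longleftrightarrow> (\<forall>x\<in>states S. ord S x x) \<and>
     (\<forall>x\<in>states S. \<forall>y\<in>states S. \<forall>z\<in>states S. ord S x y \<longrightarrow> ord S y z \<longrightarrow> ord S x z)"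

definition wqo_ts :: "'x ts \<Rightarrow> bool" where
  "wqo_ts S \<longleftrightarrow> quasi_order_on S \<and>
     (\<forall>f :: nat \<Rightarrow> 'x. (\<forall>i. f i \<in> states S) \<longrightarrow> (\<exists>i j. i < j \<and> ord S (f i) (f j)))"

definition wsts :: "'x ts \<Rightarrow> bool" where
  "wsts S \<longleftrightarrow> ts_wf S \<and> wqo_ts S \<and>
     (\<forall>a x y x'. step S a x y \<and> x' \<in> states S \<and> ord S x x' \<longrightarrow>
        (\<exists>w y'. steps S w x' y' \<and> ord S y y'))"

definition strong_mono :: "'x ts \<Rightarrow> bool" where
  "strong_mono S \<longleftrightarrow>
     (\<forall>a x y x'. step S a x y \<and> x' \<in> states S \<and> ord S x x' \<longrightarrow>
        (\<exists>y'. step S a x' y' \<and> ord S y y'))"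

definition strong_strict_mono :: "'x ts \<Rightarrow> bool" where
  "strong_strict_mono S \<longleftrightarrow>
     (\<forall>a x y x'. step S a x y \<and> x' \<in> states S \<and> ord S x x' \<longrightarrow>
        (\<exists>y'. step S a x' y' \<and> ord S y y' \<and> (less_ts S x x' \<longrightarrow> less_ts S y y')))"

definition deterministic :: "'x ts \<Rightarrow> bool" where
  "deterministic S \<longleftrightarrow> (\<forall>a x y y'. step S a x y \<and> step S a x y' \<longrightarrow> y = y')"

definition directed_in :: "'x ts \<Rightarrow> 'x set \<Rightarrow> bool" where
  "directed_in S D \<longleftrightarrow> (\<forall>x\<in>D. \<forall>y\<in>D. \<exists>z\<in>D. ord S x z \<and> ord S y z)"

definition Idl :: "'x ts \<Rightarrow> 'x set set" where
  "Idl S = {I. I \<subseteq> states S \<and> I \<noteq> {} \<and> down S I = I \<and> directed_in S I}"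

definition cstep :: "'x ts \<Rightarrow> nat \<Rightarrow> 'x set \<Rightarrow> 'x set \<Rightarrow> bool" where
  "cstep S a I J \<longleftrightarrow> a \<in> alph S \<and> I \<in> Idl S \<and> J \<in> Idl S \<and> J \<subseteq> down S (PostSet S I [a]) \<and>
     (\<forall>J'\<in>Idl S. J \<subseteq> J' \<and> J' \<subseteq> down S (PostSet S I [a]) \<longrightarrow> J' = J)"

definition completion :: "'x ts \<Rightarrow> 'x set ts" where
  "completion S = \<lparr>states = Idl S, alph = alph S, step = cstep S, ord = (\<subseteq>)\<rparr>"

text \<open>w(I) in the (deterministic) completion; None if undefined.\<close>
definition cword :: "'x ts \<Rightarrow> nat list \<Rightarrow> 'x set \<Rightarrow> 'x set option" where
  "cword S w I = (if \<exists>J. steps (completion S) w I J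
                  then Some (THE J. steps (completion S) w I J) else None)"

fun cword_pow :: "'x ts \<Rightarrow> nat list \<Rightarrow> nat \<Rightarrow> 'x set \<Rightarrow> 'x set option" where
  "cword_pow S w 0 I = Some I"
| "cword_pow S w (Suc k) I = (case cword_pow S w k I of None \<Rightarrow> None | Some J \<Rightarrow> cword S w J)"

definition winf :: "'x ts \<Rightarrow> nat list \<Rightarrow> 'x set \<Rightarrow> 'x set" where
  "winf S w I = (if \<exists>J. cword S w I = Some J \<and> I \<subset> J
                 then \<Union>{J. \<exists>k. cword_pow S w k I = Some J} else I)"

fun Idl_level :: "'x ts \<Rightarrow> nat \<Rightarrow> 'x set set" where
  "Idl_level S 0 = Idl S"
| "Idl_level S (Suc n) = {\<Union>(range f) | f. (\<forall>k. f k \<in> Idl_level S n) \<and> (\<forall>k. f k \<subset> f (Suc k))}"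

definition finitely_many_levels :: "'x ts \<Rightarrow> bool" where
  "finitely_many_levels S \<longleftrightarrow> (\<exists>n. Idl_level S n = {})"

definition very_wsts :: "'x ts \<Rightarrow> bool" where
  "very_wsts S \<longleftrightarrow> wsts S \<and> strong_mono S \<and>
     wsts (completion S) \<and> deterministic (completion S) \<and> strong_strict_mono (completion S) \<and>
     finitely_many_levels S"

definition positive_for :: "'x ts \<Rightarrow> nat list \<Rightarrow> 'x \<Rightarrow> bool" where
  "positive_for S w x \<longleftrightarrow> (\<exists>z. steps S w x z \<and> ord S x z)"

definition positive_word :: "'x ts \<Rightarrow> nat list \<Rightarrow> bool" where
  "positive_word S w \<longleftrightarrow> (\<forall>x\<in>states S. Post S x w \<noteq> {} \<longrightarrow> positive_for S w x)"

definition positive_ts :: "'x ts \<Rightarrow> bool" where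
  "positive_ts S \<longleftrightarrow> (\<forall>w. \<forall>x\<in>states S. positive_for S w x \<longrightarrow> positive_word S w)"

definition rep_coverable :: "'x ts \<Rightarrow> 'x \<Rightarrow> 'x \<Rightarrow> bool" where
  "rep_coverable S x y \<longleftrightarrow> (\<exists>z :: nat \<Rightarrow> 'x.
      (\<exists>w. steps S w x (z 0)) \<and>
      (\<forall>i. \<exists>w. w \<noteq> [] \<and> steps S w (z i) (z (Suc i))) \<and>
      (\<forall>i. ord S y (z i)))"

type_synonym nfa = "nat list \<times> (nat \<times> nat \<times> nat) list \<times> nat list"

inductive nfa_run :: "(nat \<times> nat \<times> nat) list \<Rightarrow> nat \<Rightarrow> nat list \<Rightarrow> nat \<Rightarrow> bool" for tr where
  "nfa_run tr q [] q"
| "(q, a, q') \<in> set tr \<Longrightarrow> nfa_run tr q' w q'' \<Longrightarrow> nfa_run tr q (a # w) q''"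

definition nfa_lang :: "nfa \<Rightarrow> nat list set" where
  "nfa_lang A = (case A of (ini, tr, fin) \<Rightarrow>
     {w. \<exists>q0\<in>set ini. \<exists>qf\<in>set fin. nfa_run tr q0 w qf})"

definition nfa_over :: "nfa \<Rightarrow> nat set \<Rightarrow> bool" where
  "nfa_over A \<Sigma> \<longleftrightarrow> (\<forall>(p, a, q)\<in>set (fst (snd A)). a \<in> \<Sigma>)"

definition nfa_code :: "nfa \<Rightarrow> nat" where
  "nfa_code A = (case A of (ini, tr, fin) \<Rightarrow>
     list_encode [list_encode ini, list_encode (map (\<lambda>(p, a, q). list_encode [p, a, q]) tr),
                  list_encode fin])"

text \<open>The class is C = sysOf ` Codes: each code s \<in> Codes describes the system sysOf s.
  States of system s are represented by codes via stOf s, ideals via idlOf s.\<close>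

definition completion_post_effective ::
  "(nat \<Rightarrow> 'x ts) \<Rightarrow> nat set \<Rightarrow> (nat \<Rightarrow> nat \<Rightarrow> 'x) \<Rightarrow> (nat \<Rightarrow> nat \<Rightarrow> 'x set) \<Rightarrow> bool" where
  "completion_post_effective sysOf Codes stOf idlOf \<longleftrightarrow>
     \<comment> \<open>every ideal has a representation\<close>
     (\<forall>s\<in>Codes. Idl (sysOf s) \<subseteq> range (idlOf s)) \<and>
     \<comment> \<open>the alphabet of a system can be computed (as a list)\<close>
     (\<exists>p. computes_on p {[s] | s. s \<in> Codes}
            (\<lambda>xs r. set (list_decode r) = alph (sysOf (xs ! 0)))) \<and>
     \<comment> \<open>the ideal down{x} can be computed from x\<close>
     (\<exists>p. computes_on p {[s, m] | s m. s \<in> Codes \<and> stOf s m \<in> states (sysOf s)}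
            (\<lambda>xs r. idlOf (xs ! 0) r = down (sysOf (xs ! 0)) {stOf (xs ! 0) (xs ! 1)})) \<and>
     \<comment> \<open>inclusion of ideals is decidable\<close>
     (\<exists>p. decides_on p {[s, i, j] | s i j. s \<in> Codes \<and> idlOf s i \<in> Idl (sysOf s) \<and> idlOf s j \<in> Idl (sysOf s)}
            (\<lambda>xs. idlOf (xs ! 0) (xs ! 1) \<subseteq> idlOf (xs ! 0) (xs ! 2))) \<and>
     \<comment> \<open>completion successors are computable (as a list of codes)\<close>
     (\<exists>p. computes_on p {[s, i, a] | s i a. s \<in> Codes \<and> idlOf s i \<in> Idl (sysOf s) \<and> a \<in> alph (sysOf s)}
            (\<lambda>xs r. idlOf (xs ! 0) ` set (list_decode r) =
                    {J. cstep (sysOf (xs ! 0)) (xs ! 2) (idlOf (xs ! 0) (xs ! 1)) J}))"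

definition inf_completion_effective ::
  "(nat \<Rightarrow> 'x ts) \<Rightarrow> nat set \<Rightarrow> (nat \<Rightarrow> nat \<Rightarrow> 'x set) \<Rightarrow> bool" where
  "inf_completion_effective sysOf Codes idlOf \<longleftrightarrow>
     (\<exists>p. computes_on p {[s, i, wc] | s i wc. s \<in> Codes \<and> idlOf s i \<in> Idl (sysOf s) \<and>
                                           set (list_decode wc) \<subseteq> alph (sysOf s)}
            (\<lambda>xs r. idlOf (xs ! 0) r =
                    winf (sysOf (xs ! 0)) (list_decode (xs ! 2)) (idlOf (xs ! 0) (xs ! 1))))"

definition positive_effective :: "(nat \<Rightarrow> 'x ts) \<Rightarrow> nat set \<Rightarrow> bool" where
  "positive_effective sysOf Codes \<longleftrightarrow>
     (\<exists>p. decides_on p {[s, nfa_code A] | s A. s \<in> Codes \<and> nfa_over A (alph (sysOf s))}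
            (\<lambda>xs. \<exists>A. xs ! 1 = nfa_code A \<and>
                       (\<exists>w\<in>nfa_lang A. positive_word (sysOf (xs ! 0)) w)))"

end

theory Submission
  imports Defs
begin

text \<open>
  In the completion of a very-WSTS a step maps an ideal \<open>I\<close> to the downward closure of its
  successors. Let \<open>R\<close> be the set of ideals obtained from the initial ideal by steps and
  accelerations. Steps preserve the level of an ideal and proper accelerations raise it, so
  finiteness of the levels together with the wqo on ideals yields a finite \<open>F \<subseteq> R\<close> that
  dominates all of \<open>R\<close>. By the wqo on states, \<open>y\<close> is repeatedly coverable iff some nonempty word
  \<open>v\<close> is positive for some reachable \<open>z \<ge> y\<close>; positivity of the system makes \<open>v\<close> a positive word.
  If \<open>I\<close> is a maximal member of \<open>F\<close> containing \<open>z\<close>, then \<open>v\<close> maps \<open>I\<close> exactly to itself, and by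
  strictness all intermediate ideals are members of \<open>F\<close> as well. Hence repeated coverability
  amounts to the existence of a positive word in the language of the finite automaton whose
  transitions are the exact steps inside \<open>F\<close>.

  For the algorithm, both answers are expressed as \<open>\<Sigma>\<^sub>1\<close> formulas over the graphs of the given
  programs. These graphs are themselves \<open>\<Sigma>\<^sub>1\<close>, although the programs may diverge outside their
  domains, and a search for a witness of either formula decides the problem.
\<close>

section \<open>Recursive functions and recursively enumerable predicates\<close>

lemma evalr_functional:
  assumes "evalr p xs y" "evalr p xs z"
  shows "y = z"
  using assms
proof (induction arbitrary: z rule: evalr.induct)
  case (ev_comp ys gs xs f y)
  from ev_comp.prems obtain ys' where ys': "length ys' = length gs"
    "\<forall>i<length gs. evalr (gs ! i) xs (ys' ! i)" "evalr f ys' z"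
    by (auto elim: evalr.cases)
  have "ys' = ys"
    using ys' ev_comp.hyps ev_comp.IH by (intro nth_equalityI) auto
  then show ?case using ev_comp.IH ys' by auto
next
  case (ev_prec0 f xs y g)
  from ev_prec0.prems show ?case by cases (use ev_prec0.IH in auto)
next
  case (ev_precS f g n xs y z')
  from ev_precS.prems show ?case by cases (use ev_precS.IH in auto)
next
  case (ev_min f n xs)
  from ev_min.prems have z: "evalr f (z # xs) 0" "\<forall>m<z. \<exists>k. k \<noteq> 0 \<and> evalr f (m # xs) k"
    by (cases, auto)+
  \<comment> \<open>If \<open>n\<close> were below \<open>z\<close>, then \<open>f\<close> would
    have both the value 0 and a nonzero value at \<open>n\<close>.\<close>
  have "\<not> n < z" using ev_min.IH(1) z(2) by metis
  moreover have "\<not> z < n" using ev_min.IH(2) z(1) by metis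
  ultimately show ?case by simp
qed (auto elim: evalr.cases)

lemma evalr_Comp1:
  "evalr g xs a \<Longrightarrow> evalr f [a] c \<Longrightarrow> evalr (Comp f [g]) xs c"
  by (rule ev_comp[of "[a]"]) auto

lemma evalr_Comp2:
  "evalr g xs a \<Longrightarrow> evalr h xs b \<Longrightarrow> evalr f [a, b] c \<Longrightarrow> evalr (Comp f [g, h]) xs c"
  by (rule ev_comp[of "[a, b]"]) (auto simp: less_Suc_eq)

lemma evalr_PRec:
  assumes "evalr f xs (h 0)" "\<And>n. evalr g (h n # n # xs) (h (Suc n))"
  shows "evalr (PRec f g) (n # xs) (h n)"
  by (induction n) (auto intro: assms evalr.intros)

lemma evalr_MinR_Least:
  assumes "\<And>n. evalr f (n # xs) (k n)" "\<exists>n. k n = 0"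
  shows "evalr (MinR f) xs (LEAST n. k n = 0)"
proof (rule ev_min)
  have "k (LEAST n. k n = 0) = 0" using assms(2) by (rule LeastI_ex)
  then show "evalr f ((LEAST n. k n = 0) # xs) 0" using assms(1) by metis
qed (use assms(1) not_less_Least in fastforce)

lemma evalr_Proj0: "evalr (Proj 0) (x # xs) x"
  using ev_proj[of 0 "x # xs"] by simp

lemma evalr_Proj1: "evalr (Proj (Suc 0)) (x # y # xs) y"
  using ev_proj[of "Suc 0" "x # y # xs"] by simp

lemma evalr_Proj2: "evalr (Proj (Suc (Suc 0))) (x # y # z # xs) z"
  using ev_proj[of "Suc (Suc 0)" "x # y # z # xs"] by simp

lemmas evalr_basic = evalr_Proj0 evalr_Proj1 evalr_Proj2 ev_succ ev_zero evalr_Comp1 evalr_Comp2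

section \<open>Arithmetic and the Cantor pairing as programs\<close>

definition rec_add :: recf where
  "rec_add = PRec (Proj 0) (Comp Succ [Proj 0])"

text \<open>Recursion runs on the first argument, so the subtrahend comes first. The inner
  \<open>PRec Zero (Proj (Suc 0))\<close> is the predecessor.\<close>

definition rec_minus :: recf where
  "rec_minus = PRec (Proj 0) (Comp (PRec Zero (Proj (Suc 0))) [Proj 0])"

definition rec_triangle :: recf where
  "rec_triangle = PRec Zero (Comp Succ [Comp rec_add [Proj 0, Proj (Suc 0)]])"

lemma evalr_rec_add: "evalr rec_add [m, n] (m + n)"
  unfolding rec_add_def
  by (rule evalr_PRec[where h = "\<lambda>m. m + n"]) (auto intro: evalr_basic)

lemma evalr_rec_minus: "evalr rec_minus [n, m] (m - n)"
proof -
  have "evalr (PRec Zero (Proj (Suc 0))) [k] (k - 1)" for k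
    by (rule evalr_PRec[where h = "\<lambda>k. k - 1"]) (auto intro: evalr_basic)
  then have "evalr (PRec Zero (Proj (Suc 0))) [m - k] (m - Suc k)" for k
    by (metis diff_Suc_eq_diff_pred diff_commute One_nat_def)
  then show ?thesis unfolding rec_minus_def
    by (intro evalr_PRec[where h = "\<lambda>n. m - n"]) (auto intro: evalr_basic)
qed

lemma evalr_rec_triangle: "evalr rec_triangle [n] (triangle n)"
  unfolding rec_triangle_def
proof (rule evalr_PRec[where h = triangle])
  show "evalr (Comp Succ [Comp rec_add [Proj 0, Proj (Suc 0)]]) [triangle n, n] (triangle (Suc n))" for n
    using evalr_Comp1[OF evalr_Comp2[OF evalr_Proj0 evalr_Proj1 evalr_rec_add] ev_succ] by simp
qed (auto intro: ev_zero)

lemma evalr_minus: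
  "evalr p xs a \<Longrightarrow> evalr q xs b \<Longrightarrow> evalr (Comp rec_minus [q, p]) xs (a - b)"
  by (rule evalr_Comp2[OF _ _ evalr_rec_minus])

lemma evalr_add:
  "evalr p xs a \<Longrightarrow> evalr q xs b \<Longrightarrow> evalr (Comp rec_add [p, q]) xs (a + b)"
  by (rule evalr_Comp2[OF _ _ evalr_rec_add])

lemma evalr_triangle:
  "evalr p xs a \<Longrightarrow> evalr (Comp rec_triangle [p]) xs (triangle a)"
  by (rule evalr_Comp1[OF _ evalr_rec_triangle])

definition rec_pair :: recf where
  "rec_pair = Comp rec_add [Comp rec_triangle [rec_add], Proj 0]"

lemma evalr_rec_pair: "evalr rec_pair [m, n] (prod_encode (m, n))"
  unfolding rec_pair_def prod_encode_def prod.case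
  by (intro evalr_add evalr_triangle evalr_rec_add evalr_Proj0)

lemma triangle_mono: "m \<le> n \<Longrightarrow> triangle m \<le> triangle n"
  by (rule lift_Suc_mono_le[of triangle]) auto

text \<open>The code is \<open>triangle (m + n) + m\<close>, so it lies on the diagonal
  \<open>m + n\<close>: the first \<open>s\<close> with the code below
  \<open>triangle (Suc s)\<close> is \<open>m + n\<close>. Finding the diagonal by minimisation is
  what inverts the pairing.\<close>

lemma Least_triangle_prod_encode:
  "(LEAST s. Suc (prod_encode (m, n)) - triangle (Suc s) = 0) = m + n"
proof (rule Least_equality)
  fix s assume "Suc (prod_encode (m, n)) - triangle (Suc s) = 0"
  then have "triangle (m + n) < triangle (Suc s)"
    by (simp add: prod_encode_def)
  then show "m + n \<le> s" using triangle_mono[of "Suc s" "m + n"] by linarith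
qed (simp add: prod_encode_def)

definition rec_sum :: recf where
  "rec_sum = MinR (Comp rec_minus [Comp rec_triangle [Comp Succ [Proj 0]], Comp Succ [Proj (Suc 0)]])"

lemma evalr_rec_sum: "evalr rec_sum [prod_encode (m, n)] (m + n)"
proof -
  have "evalr rec_sum [prod_encode (m, n)] (LEAST s. Suc (prod_encode (m, n)) - triangle (Suc s) = 0)"
    unfolding rec_sum_def
  proof (rule evalr_MinR_Least)
    show "\<exists>s. Suc (prod_encode (m, n)) - triangle (Suc s) = 0"
      by (rule exI[of _ "m + n"]) (simp add: prod_encode_def)
  qed (intro evalr_minus evalr_triangle evalr_Comp1[OF _ ev_succ] evalr_Proj0 evalr_Proj1)
  then show ?thesis unfolding Least_triangle_prod_encode .
qed

definition rec_fst :: recf where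
  "rec_fst = Comp rec_minus [Comp rec_triangle [rec_sum], Proj 0]"

definition rec_snd :: recf where
  "rec_snd = Comp rec_minus [rec_fst, rec_sum]"

lemma evalr_rec_fst': "evalr rec_fst [prod_encode (m, n)] m"
proof -
  have "evalr rec_fst [prod_encode (m, n)] (prod_encode (m, n) - triangle (m + n))"
    unfolding rec_fst_def by (intro evalr_minus evalr_triangle evalr_rec_sum evalr_Proj0)
  then show ?thesis by (simp add: prod_encode_def)
qed

lemma evalr_rec_snd': "evalr rec_snd [prod_encode (m, n)] n"
  using evalr_minus[OF evalr_rec_sum evalr_rec_fst', of m n] unfolding rec_snd_def by simp

abbreviation pair :: "nat \<Rightarrow> nat \<Rightarrow> nat" where
  "pair x y \<equiv> prod_encode (x, y)"

definition pfst :: "nat \<Rightarrow> nat" where "pfst z = fst (prod_decode z)"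
definition psnd :: "nat \<Rightarrow> nat" where "psnd z = snd (prod_decode z)"

lemma pfst_pair [simp]: "pfst (pair x y) = x"
  by (simp add: pfst_def)

lemma psnd_pair [simp]: "psnd (pair x y) = y"
  by (simp add: psnd_def)

lemma pair_cases: obtains x y where "z = pair x y"
  by (metis prod_decode_inverse surj_pair)

section \<open>Total computable functions of one argument\<close>

definition total_rec :: "(nat \<Rightarrow> nat) \<Rightarrow> bool" where
  "total_rec f \<longleftrightarrow> (\<exists>p. \<forall>x. evalr p [x] (f x))"

lemma total_rec_id: "total_rec (\<lambda>x. x)"
  unfolding total_rec_def using evalr_Proj0 by blast

lemma total_rec_comp: "total_rec f \<Longrightarrow> total_rec g \<Longrightarrow> total_rec (\<lambda>x. f (g x))"
  unfolding total_rec_def using evalr_Comp1 by meson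

lemma total_rec_Suc: "total_rec f \<Longrightarrow> total_rec (\<lambda>x. Suc (f x))"
  unfolding total_rec_def using evalr_Comp1 ev_succ by meson

lemma total_rec_const: "total_rec (\<lambda>x. c)"
proof (induction c)
  case 0
  then show ?case unfolding total_rec_def using ev_zero by blast
qed (rule total_rec_Suc)

lemma total_rec_add: "total_rec f \<Longrightarrow> total_rec g \<Longrightarrow> total_rec (\<lambda>x. f x + g x)"
  unfolding total_rec_def using evalr_add by meson

lemma total_rec_minus: "total_rec f \<Longrightarrow> total_rec g \<Longrightarrow> total_rec (\<lambda>x. f x - g x)"
  unfolding total_rec_def using evalr_minus by meson

lemma total_rec_pair: "total_rec f \<Longrightarrow> total_rec g \<Longrightarrow> total_rec (\<lambda>x. pair (f x) (g x))"
  unfolding total_rec_def using evalr_Comp2[OF _ _ evalr_rec_pair] by meson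

lemma evalr_rec_fst: "evalr rec_fst [z] (pfst z)"
  using evalr_rec_fst' by (cases z rule: pair_cases) simp

lemma evalr_rec_snd: "evalr rec_snd [z] (psnd z)"
  using evalr_rec_snd' by (cases z rule: pair_cases) simp

lemma total_rec_pfst: "total_rec f \<Longrightarrow> total_rec (\<lambda>x. pfst (f x))"
  unfolding total_rec_def using evalr_Comp1[OF _ evalr_rec_fst] by meson

lemma total_rec_psnd: "total_rec f \<Longrightarrow> total_rec (\<lambda>x. psnd (f x))"
  unfolding total_rec_def using evalr_Comp1[OF _ evalr_rec_snd] by meson

lemma total_rec_rec_nat:
  assumes "total_rec b" "total_rec m" "total_rec (\<lambda>z. h (pfst z) (pfst (psnd z)) (psnd (psnd z)))"
  shows "total_rec (\<lambda>x. rec_nat (b x) (\<lambda>n acc. h x n acc) (m x))"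
proof -
  obtain pb pm ph where p: "\<And>x. evalr pb [x] (b x)" "\<And>x. evalr pm [x] (m x)"
    "\<And>z. evalr ph [z] (h (pfst z) (pfst (psnd z)) (psnd (psnd z)))"
    using assms unfolding total_rec_def by blast
  \<comment> \<open>\<open>PRec\<close> passes accumulator, counter and parameter in this order; the
    wrapper repacks them as the nested pair that \<open>ph\<close> expects.\<close>
  let ?g = "Comp ph [Comp rec_pair [Proj (Suc (Suc 0)), Comp rec_pair [Proj (Suc 0), Proj 0]]]"
  have g: "evalr ?g [acc, n, x] (h x n acc)" for acc n x
    using evalr_Comp1[OF evalr_Comp2[OF evalr_Proj2
        evalr_Comp2[OF evalr_Proj1 evalr_Proj0 evalr_rec_pair] evalr_rec_pair] p(3)] by simp
  have "evalr (PRec pb ?g) [n, x] (rec_nat (b x) (\<lambda>n acc. h x n acc) n)" for n x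
    by (rule evalr_PRec) (use p(1) g in auto)
  then have "evalr (Comp (PRec pb ?g) [pm, Proj 0]) [x] (rec_nat (b x) (\<lambda>n acc. h x n acc) (m x))" for x
    using evalr_Comp2 p(2) evalr_Proj0 by blast
  then show ?thesis unfolding total_rec_def by blast
qed

lemma total_rec_mult:
  assumes "total_rec f" "total_rec g"
  shows "total_rec (\<lambda>x. f x * g x)"
proof -
  have "rec_nat 0 (\<lambda>_ acc. k + acc) n = n * k" for k n :: nat
    by (induction n) auto
  moreover have "total_rec (\<lambda>x. rec_nat 0 (\<lambda>_ acc. g x + acc) (f x))"
    by (intro total_rec_rec_nat total_rec_const total_rec_add total_rec_psnd
        total_rec_id total_rec_comp[OF assms(2)] total_rec_pfst assms(1))
  ultimately show ?thesis by simp
qed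

section \<open>Access to coded lists\<close>

definition hdc :: "nat \<Rightarrow> nat" where "hdc c = pfst (c - 1)"
definition tlc :: "nat \<Rightarrow> nat" where "tlc c = psnd (c - 1)"
definition dropc :: "nat \<Rightarrow> nat \<Rightarrow> nat" where "dropc c i = rec_nat c (\<lambda>_. tlc) i"
definition nthc :: "nat \<Rightarrow> nat \<Rightarrow> nat" where "nthc c i = hdc (dropc c i)"

lemma total_rec_hdc: "total_rec f \<Longrightarrow> total_rec (\<lambda>x. hdc (f x))"
  unfolding hdc_def by (intro total_rec_pfst total_rec_minus total_rec_const)

lemma total_rec_tlc: "total_rec f \<Longrightarrow> total_rec (\<lambda>x. tlc (f x))"
  unfolding tlc_def by (intro total_rec_psnd total_rec_minus total_rec_const)

lemma total_rec_dropc: "total_rec f \<Longrightarrow> total_rec g \<Longrightarrow> total_rec (\<lambda>x. dropc (f x) (g x))"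
  unfolding dropc_def
  by (intro total_rec_rec_nat total_rec_tlc total_rec_psnd total_rec_id)

lemma total_rec_nthc: "total_rec f \<Longrightarrow> total_rec g \<Longrightarrow> total_rec (\<lambda>x. nthc (f x) (g x))"
  unfolding nthc_def by (intro total_rec_hdc total_rec_dropc)

lemma list_decode_eq_Nil_iff: "list_decode c = [] \<longleftrightarrow> c = 0"
  by (metis list_decode.simps(1) list_decode_inverse)

text \<open>A nonempty list is coded by the successor of a pair, which explains the predecessor in
  \<open>hdc\<close> and \<open>tlc\<close>.\<close>

lemma list_decode_hdc_tlc: "c \<noteq> 0 \<Longrightarrow> list_decode c = hdc c # list_decode (tlc c)"
  by (cases c) (auto simp: hdc_def tlc_def pfst_def psnd_def split: prod.split)

lemma tlc_0: "tlc 0 = 0"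
  using psnd_pair[of 0 0] by (simp add: tlc_def prod_encode_def del: psnd_pair)

lemma list_decode_dropc: "list_decode (dropc c i) = drop i (list_decode c)"
proof (induction i)
  case (Suc i)
  have "list_decode (tlc d) = tl (list_decode d)" for d
    by (cases "d = 0") (auto simp: tlc_0 list_decode_hdc_tlc)
  then show ?case using Suc by (simp add: dropc_def drop_Suc tl_drop)
qed (simp add: dropc_def)

text \<open>Gives a computable test that an index is in range, for turning list quantifiers into
  quantifiers over indices.\<close>

lemma dropc_nonzero_iff: "dropc c i \<noteq> 0 \<longleftrightarrow> i < length (list_decode c)"
  using list_decode_eq_Nil_iff[of "dropc c i"] by (auto simp: list_decode_dropc)

lemma nthc_eq_nth: "i < length (list_decode c) \<Longrightarrow> nthc c i = list_decode c ! i"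
  using list_decode_hdc_tlc[of "dropc c i"] dropc_nonzero_iff[of c i] unfolding nthc_def
  by (metis list_decode_dropc hd_drop_conv_nth list.sel(1))

text \<open>The tail of a nonempty list has a strictly smaller code. The code thus bounds all
  indices, and a universal quantifier over a coded list becomes a bounded one.\<close>

lemma length_list_decode_le: "length (list_decode c) \<le> c"
proof (induction c rule: less_induct)
  case (less c)
  show ?case
  proof (cases "c = 0")
    case False
    then have "tlc c < c"
      using le_prod_encode_2[of "psnd (c - 1)" "pfst (c - 1)"]
      by (simp add: tlc_def pfst_def psnd_def)
    then show ?thesis using less[of "tlc c"] False by (simp add: list_decode_hdc_tlc)
  qed simp
qed

text \<open>Any finite sequence of values is a coded list, so one number can stand for finitely many
  choices at once.\<close>

lemma nthc_choice: "\<exists>c. \<forall>i<n. nthc c i = f i"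
proof
  show "\<forall>i<n. nthc (list_encode (map f [0..<n])) i = f i"
    by (simp add: nthc_eq_nth)
qed

section \<open>Closure properties of recursively enumerable predicates\<close>

definition re :: "(nat \<Rightarrow> bool) \<Rightarrow> bool" where
  "re P \<longleftrightarrow> (\<exists>g. total_rec g \<and> (\<forall>x. P x \<longleftrightarrow> (\<exists>t. g (pair x t) = 0)))"

lemma reI: "total_rec g \<Longrightarrow> (\<And>x. P x \<longleftrightarrow> (\<exists>t. g (pair x t) = 0)) \<Longrightarrow> re P"
  unfolding re_def by blast

lemma re_subst:
  assumes "re P" "total_rec f"
  shows "re (\<lambda>x. P (f x))"
proof -
  obtain g where g: "total_rec g" "\<And>x. P x \<longleftrightarrow> (\<exists>t. g (pair x t) = 0)"
    using assms(1) unfolding re_def by blast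
  show ?thesis
  proof (rule reI)
    show "total_rec (\<lambda>z. g (pair (f (pfst z)) (psnd z)))"
      by (intro total_rec_comp[OF g(1)] total_rec_pair total_rec_comp[OF assms(2)]
          total_rec_pfst total_rec_psnd total_rec_id)
  qed (simp add: g(2))
qed

text \<open>Since membership is witnessed by zeros, conjunction becomes a sum, with both witnesses
  packed into one number. Disjunction becomes a product in the same way.\<close>

lemma re_conj:
  assumes "re P" "re Q"
  shows "re (\<lambda>x. P x \<and> Q x)"
proof -
  obtain g h where g: "total_rec g" "\<And>x. P x \<longleftrightarrow> (\<exists>t. g (pair x t) = 0)"
    and h: "total_rec h" "\<And>x. Q x \<longleftrightarrow> (\<exists>t. h (pair x t) = 0)"
    using assms unfolding re_def by blast
  show ?thesis
  proof (rule reI)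
    show "total_rec (\<lambda>z. g (pair (pfst z) (pfst (psnd z))) + h (pair (pfst z) (psnd (psnd z))))"
      by (intro total_rec_add total_rec_comp[OF g(1)] total_rec_comp[OF h(1)] total_rec_pair
          total_rec_pfst total_rec_psnd total_rec_id)
    show "P x \<and> Q x \<longleftrightarrow> (\<exists>t. g (pair (pfst (pair x t)) (pfst (psnd (pair x t))))
        + h (pair (pfst (pair x t)) (psnd (psnd (pair x t)))) = 0)" for x
      by (auto simp: g(2) h(2)) (metis pfst_pair psnd_pair)
  qed
qed

lemma re_disj:
  assumes "re P" "re Q"
  shows "re (\<lambda>x. P x \<or> Q x)"
proof -
  obtain g h where g: "total_rec g" "\<And>x. P x \<longleftrightarrow> (\<exists>t. g (pair x t) = 0)"
    and h: "total_rec h" "\<And>x. Q x \<longleftrightarrow> (\<exists>t. h (pair x t) = 0)"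
    using assms unfolding re_def by blast
  show ?thesis
    by (rule reI[OF total_rec_mult[OF g(1) h(1)]]) (auto simp: g(2) h(2))
qed

lemma re_ex:
  assumes "re (\<lambda>z. P (pfst z) (psnd z))"
  shows "re (\<lambda>x. \<exists>y. P x y)"
proof -
  obtain g where g: "total_rec g" "\<And>z. P (pfst z) (psnd z) \<longleftrightarrow> (\<exists>t. g (pair z t) = 0)"
    using assms unfolding re_def by blast
  have g2: "P x y \<longleftrightarrow> (\<exists>t. g (pair (pair x y) t) = 0)" for x y
    using g(2)[of "pair x y"] by simp
  show ?thesis
  proof (rule reI)
    show "total_rec (\<lambda>z. g (pair (pair (pfst z) (pfst (psnd z))) (psnd (psnd z))))"
      by (intro total_rec_comp[OF g(1)] total_rec_pair total_rec_pfst total_rec_psnd total_rec_id)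
    show "(\<exists>y. P x y) \<longleftrightarrow>
      (\<exists>t. g (pair (pair (pfst (pair x t)) (pfst (psnd (pair x t)))) (psnd (psnd (pair x t)))) = 0)" for x
      by (auto simp: g2) (metis pfst_pair psnd_pair)
  qed
qed

text \<open>Collection: the witnesses for all \<open>i < f x\<close> are gathered in one list code,
  and the sum of the individual test values vanishes exactly if each of them does.\<close>

lemma re_all_less:
  assumes "total_rec f" "re (\<lambda>z. P (pfst z) (psnd z))"
  shows "re (\<lambda>x. \<forall>i<f x. P x i)"
proof -
  obtain g where g: "total_rec g" "\<And>z. P (pfst z) (psnd z) \<longleftrightarrow> (\<exists>t. g (pair z t) = 0)"
    using assms unfolding re_def by blast
  have g2: "P x y \<longleftrightarrow> (\<exists>t. g (pair (pair x y) t) = 0)" for x y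
    using g(2)[of "pair x y"] by simp
  let ?h = "\<lambda>z. rec_nat 0 (\<lambda>i acc. g (pair (pair (pfst z) i) (nthc (psnd z) i)) + acc) (f (pfst z))"
  have sum: "rec_nat 0 (\<lambda>i acc. a i + acc) n = 0 \<longleftrightarrow> (\<forall>i<n. a i = 0)" for a :: "nat \<Rightarrow> nat" and n
    by (induction n) (auto simp: less_Suc_eq)
  show ?thesis
  proof (rule reI)
    show "total_rec ?h"
      by (intro total_rec_rec_nat total_rec_add total_rec_comp[OF g(1)] total_rec_comp[OF assms(1)]
          total_rec_pair total_rec_nthc total_rec_pfst total_rec_psnd total_rec_id total_rec_const)
    show "(\<forall>i<f x. P x i) \<longleftrightarrow> (\<exists>t. ?h (pair x t) = 0)" for x
    proof
      assume "\<forall>i<f x. P x i"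
      then obtain t where t: "\<forall>i<f x. g (pair (pair x i) (t i)) = 0"
        unfolding g2 by metis
      moreover obtain c where "\<forall>i<f x. nthc c i = t i" using nthc_choice by blast
      ultimately show "\<exists>t. ?h (pair x t) = 0" by (auto simp: sum intro!: exI[of _ c])
    qed (auto simp: sum g2)
  qed
qed

lemma re_total_eq:
  assumes "total_rec f" "total_rec g"
  shows "re (\<lambda>x. f x = g x)"
proof (rule reI)
  show "total_rec (\<lambda>z. (f (pfst z) - g (pfst z)) + (g (pfst z) - f (pfst z)))"
    by (intro total_rec_add total_rec_minus total_rec_comp[OF assms(1)]
        total_rec_comp[OF assms(2)] total_rec_pfst total_rec_id)
qed auto

lemma re_total_less:
  assumes "total_rec f" "total_rec g"
  shows "re (\<lambda>x. f x < g x)"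
proof (rule reI)
  show "total_rec (\<lambda>z. Suc (f (pfst z)) - g (pfst z))"
    by (intro total_rec_Suc total_rec_minus total_rec_comp[OF assms(1)]
        total_rec_comp[OF assms(2)] total_rec_pfst total_rec_id)
qed auto

lemma re_total_neq0:
  assumes "total_rec f"
  shows "re (\<lambda>x. f x \<noteq> 0)"
  using re_total_less[OF total_rec_const[of 0] assms] by simp

lemmas total_rec_intros = total_rec_const total_rec_id total_rec_Suc total_rec_add total_rec_pair
  total_rec_pfst total_rec_psnd total_rec_hdc total_rec_tlc total_rec_dropc total_rec_nthc

lemmas re_intros = re_conj re_disj re_ex re_all_less re_total_neq0 re_total_eq re_total_less

lemma re_bex_list:
  assumes "total_rec f" "re (\<lambda>z. P (pfst z) (psnd z))"
  shows "re (\<lambda>x. \<exists>y\<in>set (list_decode (f x)). P x y)"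
proof -
  have "re (\<lambda>x. \<exists>i. dropc (f x) i \<noteq> 0 \<and> P x (nthc (f x) i))"
    by (intro re_intros re_subst[OF assms(2), of "\<lambda>z. pair (pfst z) (nthc (f (pfst z)) (psnd z))", simplified]
        total_rec_comp[OF assms(1)] total_rec_intros)
  moreover have "(\<exists>y\<in>set (list_decode c). Q y) \<longleftrightarrow> (\<exists>i. dropc c i \<noteq> 0 \<and> Q (nthc c i))" for c Q
    unfolding dropc_nonzero_iff by (metis in_set_conv_nth nthc_eq_nth)
  ultimately show ?thesis by simp
qed

lemma re_ball_list:
  assumes "total_rec f" "re (\<lambda>z. P (pfst z) (psnd z))"
  shows "re (\<lambda>x. \<forall>y\<in>set (list_decode (f x)). P x y)"
proof -
  \<comment> \<open>The indices run up to the code, which is at least the length; those past the end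
    are dismissed by \<open>dropc (f x) i = 0\<close>.\<close>
  have "re (\<lambda>x. \<forall>i<f x. dropc (f x) i = 0 \<or> P x (nthc (f x) i))"
    by (intro re_intros re_subst[OF assms(2), of "\<lambda>z. pair (pfst z) (nthc (f (pfst z)) (psnd z))", simplified]
        assms(1) total_rec_comp[OF assms(1)] total_rec_intros)
  moreover have "(\<forall>y\<in>set (list_decode c). Q y) \<longleftrightarrow> (\<forall>i<c. dropc c i = 0 \<or> Q (nthc c i))" for c Q
    unfolding all_set_conv_all_nth
    by (metis dropc_nonzero_iff length_list_decode_le nthc_eq_nth order_less_le_trans)
  ultimately show ?thesis by simp
qed

lemma re_in_list:
  assumes "total_rec f" "total_rec g"
  shows "re (\<lambda>x. g x \<in> set (list_decode (f x)))"
proof -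
  have "re (\<lambda>x. \<exists>y\<in>set (list_decode (f x)). g x = y)"
    by (intro re_bex_list assms re_intros total_rec_comp[OF assms(2)] total_rec_intros)
  then show ?thesis by simp
qed

text \<open>A finite path is one coded list, so iteration of a Sigma_1 relation costs only an
  existential and a bounded universal quantifier.\<close>

lemma rtranclp_iff_seq:
  "T\<^sup>*\<^sup>* a b \<longleftrightarrow> (\<exists>n c. nthc c 0 = a \<and> nthc c n = b \<and> (\<forall>k<n. T (nthc c k) (nthc c (Suc k))))"
proof
  assume "T\<^sup>*\<^sup>* a b"
  then obtain n f where f: "f 0 = a" "f n = b" "\<forall>k<n. T (f k) (f (Suc k))"
    by (auto simp: rtranclp_power relpowp_fun_conv)
  obtain c where "\<forall>i<Suc n. nthc c i = f i" using nthc_choice by blast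
  then show "\<exists>n c. nthc c 0 = a \<and> nthc c n = b \<and> (\<forall>k<n. T (nthc c k) (nthc c (Suc k)))"
    using f by (intro exI[of _ n] exI[of _ c]) auto
next
  assume "\<exists>n c. nthc c 0 = a \<and> nthc c n = b \<and> (\<forall>k<n. T (nthc c k) (nthc c (Suc k)))"
  then show "T\<^sup>*\<^sup>* a b"
    by (auto simp: rtranclp_power relpowp_fun_conv)
qed

lemma re_rtranclp:
  assumes "re (\<lambda>z. T (pfst z) (pfst (psnd z)) (psnd (psnd z)))" "total_rec f" "total_rec g"
  shows "re (\<lambda>x. (T x)\<^sup>*\<^sup>* (f x) (g x))"
  unfolding rtranclp_iff_seq
  by (intro re_intros
      re_subst[OF assms(1), of "\<lambda>z. pair (pfst (pfst (pfst z)))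
        (pair (nthc (psnd (pfst z)) (psnd z)) (nthc (psnd (pfst z)) (Suc (psnd z))))", simplified]
      total_rec_comp[OF assms(2)] total_rec_comp[OF assms(3)] total_rec_intros)

text \<open>The list \<open>gs\<close> belongs to a fixed program, so the induction on it runs
  outside the coding; only arguments and values are numbers.\<close>

lemma re_list_all2_evalr:
  assumes "\<And>g. g \<in> set gs \<Longrightarrow> re (\<lambda>z. evalr g (list_decode (pfst z)) (psnd z))"
  shows "re (\<lambda>z. list_all2 (\<lambda>g y. evalr g (list_decode (pfst z)) y) gs (list_decode (psnd z)))"
  using assms
proof (induction gs)
  case Nil
  have "re (\<lambda>z. psnd z = 0)" by (intro re_intros total_rec_intros)
  then show ?case by (simp add: list_decode_eq_Nil_iff)
next
  case (Cons g gs)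
  let ?R = "\<lambda>xs ys. list_all2 (\<lambda>g y. evalr g xs y) gs ys"
  have "re (\<lambda>z. ?R (list_decode (pfst z)) (list_decode (tlc (psnd z))))"
    using re_subst[OF Cons.IH, of "\<lambda>z. pair (pfst z) (tlc (psnd z))"] Cons.prems
    by (simp add: total_rec_intros)
  moreover have "re (\<lambda>z. evalr g (list_decode (pfst z)) (hdc (psnd z)))"
    using re_subst[OF Cons.prems[of g], of "\<lambda>z. pair (pfst z) (hdc (psnd z))"]
    by (simp add: total_rec_intros)
  ultimately have "re (\<lambda>z. psnd z \<noteq> 0 \<and> evalr g (list_decode (pfst z)) (hdc (psnd z))
      \<and> ?R (list_decode (pfst z)) (list_decode (tlc (psnd z))))"
    by (intro re_intros total_rec_intros)
  moreover have "list_all2 (\<lambda>g y. evalr g xs y) (g # gs) (list_decode c) \<longleftrightarrow>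
      c \<noteq> 0 \<and> evalr g xs (hdc c) \<and> ?R xs (list_decode (tlc c))" for xs c
    by (cases "c = 0") (auto simp: list_decode_hdc_tlc)
  ultimately show ?case by simp
qed

section \<open>Program graphs as Sigma_1 predicates, and decision by search\<close>

lemma evalr_Zero_iff: "evalr Zero xs r \<longleftrightarrow> r = 0"
  by (auto intro: evalr.intros elim: evalr.cases)

lemma evalr_Succ_iff: "evalr Succ xs r \<longleftrightarrow> xs \<noteq> [] \<and> r = Suc (hd xs)"
  by (cases xs) (auto intro: evalr.intros elim: evalr.cases)

lemma evalr_Proj_iff: "evalr (Proj i) xs r \<longleftrightarrow> i < length xs \<and> r = xs ! i"
  by (auto intro: evalr.intros elim: evalr.cases)

lemma evalr_Comp_iff:
  "evalr (Comp f gs) xs r \<longleftrightarrow> (\<exists>ys. list_all2 (\<lambda>g y. evalr g xs y) gs ys \<and> evalr f ys r)"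
  by (auto simp: list_all2_conv_all_nth intro: evalr.intros elim!: evalr.cases[of "Comp f gs"]) metis

lemma evalr_MinR_iff:
  "evalr (MinR f) xs r \<longleftrightarrow> evalr f (r # xs) 0 \<and> (\<forall>m<r. \<exists>k. k \<noteq> 0 \<and> evalr f (m # xs) k)"
  by (auto intro: evalr.intros elim: evalr.cases)

text \<open>The code \<open>c\<close> records the values at all stages from 0 to \<open>n\<close>,
  which removes the recursion from the description of the graph.\<close>

lemma evalr_PRec_iff:
  "evalr (PRec f g) (n # xs) r \<longleftrightarrow> (\<exists>c. evalr f xs (nthc c 0) \<and> nthc c n = r \<and>
     (\<forall>i<n. evalr g (nthc c i # i # xs) (nthc c (Suc i))))"
proof
  have "\<exists>y. evalr f xs (y 0) \<and> y n = r \<and> (\<forall>i<n. evalr g (y i # i # xs) (y (Suc i)))"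
    if "evalr (PRec f g) (n # xs) r" using that
  proof (induction n arbitrary: r)
    case 0
    then have "evalr f xs r" by (auto elim: evalr.cases)
    then show ?case by (intro exI[of _ "\<lambda>_. r"]) auto
  next
    case (Suc n)
    from Suc.prems obtain q where q: "evalr (PRec f g) (n # xs) q" "evalr g (q # n # xs) r"
      by (auto elim: evalr.cases)
    from Suc.IH[OF q(1)] obtain y where
      "evalr f xs (y 0)" "y n = q" "\<forall>i<n. evalr g (y i # i # xs) (y (Suc i))" by blast
    then show ?case using q(2) by (intro exI[of _ "y(Suc n := r)"]) (auto simp: less_Suc_eq)
  qed
  moreover assume "evalr (PRec f g) (n # xs) r"
  ultimately obtain y where
    y: "evalr f xs (y 0)" "y n = r" "\<forall>i<n. evalr g (y i # i # xs) (y (Suc i))" by blast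
  obtain c where "\<forall>i<Suc n. nthc c i = y i" using nthc_choice by blast
  then show "\<exists>c. evalr f xs (nthc c 0) \<and> nthc c n = r \<and>
     (\<forall>i<n. evalr g (nthc c i # i # xs) (nthc c (Suc i)))"
    using y by (intro exI[of _ c]) auto
next
  assume "\<exists>c. evalr f xs (nthc c 0) \<and> nthc c n = r \<and>
     (\<forall>i<n. evalr g (nthc c i # i # xs) (nthc c (Suc i)))"
  then obtain c where c: "evalr f xs (nthc c 0)" "nthc c n = r"
    "\<forall>i<n. evalr g (nthc c i # i # xs) (nthc c (Suc i))" by blast
  have "i \<le> n \<Longrightarrow> evalr (PRec f g) (i # xs) (nthc c i)" for i
    by (induction i) (use c in \<open>auto intro: evalr.intros\<close>)
  then show "evalr (PRec f g) (n # xs) r" using c(2) by auto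
qed

definition consc :: "nat \<Rightarrow> nat \<Rightarrow> nat" where "consc x c = Suc (pair x c)"

lemma list_decode_consc [simp]: "list_decode (consc x c) = x # list_decode c"
  by (simp add: consc_def)

lemma total_rec_consc: "total_rec f \<Longrightarrow> total_rec g \<Longrightarrow> total_rec (\<lambda>x. consc (f x) (g x))"
  unfolding consc_def by (intro total_rec_intros)

text \<open>Each constructor expresses its graph through those of its parts by conjunction,
  existential and bounded universal quantification. Divergence is just the absence of a
  witness.\<close>

lemma re_evalr_graph: "re (\<lambda>z. evalr p (list_decode (pfst z)) (psnd z))"
proof (induction p)
  case Zero
  show ?case unfolding evalr_Zero_iff by (intro re_intros total_rec_intros)
next
  case Succ
  have "re (\<lambda>z. pfst z \<noteq> 0 \<and> psnd z = Suc (hdc (pfst z)))"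
    by (intro re_intros total_rec_intros)
  moreover have "evalr Succ (list_decode c) r \<longleftrightarrow> c \<noteq> 0 \<and> r = Suc (hdc c)" for c r
    by (cases "c = 0") (auto simp: evalr_Succ_iff list_decode_hdc_tlc)
  ultimately show ?case by simp
next
  case (Proj i)
  have "re (\<lambda>z. dropc (pfst z) i \<noteq> 0 \<and> psnd z = nthc (pfst z) i)"
    by (intro re_intros total_rec_intros)
  moreover have "evalr (Proj i) (list_decode c) r \<longleftrightarrow> dropc c i \<noteq> 0 \<and> r = nthc c i" for c r
    unfolding evalr_Proj_iff dropc_nonzero_iff by (auto simp: nthc_eq_nth)
  ultimately show ?case by simp
next
  case (Comp f gs)
  have "re (\<lambda>z. list_all2 (\<lambda>g y. evalr g (list_decode (pfst (pfst z))) y) gs (list_decode (psnd z)))"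
    using re_subst[OF re_list_all2_evalr[OF Comp(2)], where f = "\<lambda>z. pair (pfst (pfst z)) (psnd z)"]
    by (simp add: total_rec_intros)
  moreover have "re (\<lambda>z. evalr f (list_decode (psnd z)) (psnd (pfst z)))"
    using re_subst[OF Comp(1), of "\<lambda>z. pair (psnd z) (psnd (pfst z))"] by (simp add: total_rec_intros)
  ultimately have "re (\<lambda>z. \<exists>y. list_all2 (\<lambda>g y. evalr g (list_decode (pfst z)) y) gs (list_decode y)
      \<and> evalr f (list_decode y) (psnd z))"
    by (intro re_ex re_conj)
  moreover have "evalr (Comp f gs) xs r \<longleftrightarrow> (\<exists>y. list_all2 (\<lambda>g y. evalr g xs y) gs (list_decode y)
      \<and> evalr f (list_decode y) r)" for xs r
    unfolding evalr_Comp_iff by (metis list_encode_inverse)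
  ultimately show ?case by simp
next
  case (PRec f g)
  have "re (\<lambda>z. evalr f (list_decode (tlc (pfst (pfst z)))) (nthc (psnd z) 0))"
    using re_subst[OF PRec(1), of "\<lambda>z. pair (tlc (pfst (pfst z))) (nthc (psnd z) 0)"]
    by (simp add: total_rec_intros)
  moreover have "re (\<lambda>z. evalr g (nthc (psnd (pfst z)) (psnd z) # psnd z #
       list_decode (tlc (pfst (pfst (pfst z))))) (nthc (psnd (pfst z)) (Suc (psnd z))))"
    using re_subst[OF PRec(2), of "\<lambda>z. pair (consc (nthc (psnd (pfst z)) (psnd z))
        (consc (psnd z) (tlc (pfst (pfst (pfst z)))))) (nthc (psnd (pfst z)) (Suc (psnd z)))"]
    by (simp add: total_rec_intros total_rec_consc)
  ultimately have "re (\<lambda>z. pfst z \<noteq> 0 \<and> (\<exists>c. evalr f (list_decode (tlc (pfst z))) (nthc c 0)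
      \<and> nthc c (hdc (pfst z)) = psnd z \<and> (\<forall>i<hdc (pfst z).
        evalr g (nthc c i # i # list_decode (tlc (pfst z))) (nthc c (Suc i)))))"
    by (intro re_intros total_rec_intros)
  \<comment> \<open>No rule evaluates a primitive recursion on the empty argument list, hence the
    conjunct \<open>d \<noteq> 0\<close>.\<close>
  moreover have "evalr (PRec f g) (list_decode d) r \<longleftrightarrow> d \<noteq> 0 \<and>
      (\<exists>c. evalr f (list_decode (tlc d)) (nthc c 0) \<and> nthc c (hdc d) = r \<and>
        (\<forall>i<hdc d. evalr g (nthc c i # i # list_decode (tlc d)) (nthc c (Suc i))))" for d r
    by (cases "d = 0") (auto simp: evalr_PRec_iff list_decode_hdc_tlc elim: evalr.cases)
  ultimately show ?case by simp
next
  case (MinR f)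
  have "re (\<lambda>z. evalr f (psnd z # list_decode (pfst z)) 0)"
    using re_subst[OF MinR, of "\<lambda>z. pair (consc (psnd z) (pfst z)) 0"]
    by (simp add: total_rec_intros total_rec_consc)
  moreover have "re (\<lambda>z. evalr f (psnd (pfst z) # list_decode (pfst (pfst (pfst z)))) (psnd z))"
    using re_subst[OF MinR, of "\<lambda>z. pair (consc (psnd (pfst z)) (pfst (pfst (pfst z)))) (psnd z)"]
    by (simp add: total_rec_intros total_rec_consc)
  ultimately show ?case unfolding evalr_MinR_iff by (intro re_intros total_rec_intros)
qed

lemma re_evalr:
  assumes "total_rec a" "total_rec r"
  shows "re (\<lambda>x. evalr p (list_decode (a x)) (r x))"
  using re_subst[OF re_evalr_graph, of "\<lambda>x. pair (a x) (r x)"] assms by (simp add: total_rec_pair)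

lemma re_evalr1:
  assumes "total_rec a" "total_rec r"
  shows "re (\<lambda>x. evalr p [a x] (r x))"
  using re_evalr[of "\<lambda>x. consc (a x) 0" r p] assms by (simp add: total_rec_consc total_rec_const)

lemma re_evalr2:
  assumes "total_rec a" "total_rec b" "total_rec r"
  shows "re (\<lambda>x. evalr p [a x, b x] (r x))"
  using re_evalr[of "\<lambda>x. consc (a x) (consc (b x) 0)" r p] assms
  by (simp add: total_rec_consc total_rec_const)

lemma re_evalr3:
  assumes "total_rec a" "total_rec b" "total_rec c" "total_rec r"
  shows "re (\<lambda>x. evalr p [a x, b x, c x] (r x))"
  using re_evalr[of "\<lambda>x. consc (a x) (consc (b x) (consc (c x) 0))" r p] assms
  by (simp add: total_rec_consc total_rec_const)

text \<open>Post's theorem relative to a domain: on \<open>D\<close> exactly one of \<open>P\<close>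
  and \<open>N\<close> has a witness, so the search for a zero of the product of both tests
  terminates. Off \<open>D\<close> it may diverge.\<close>

lemma decides_on_triples_if_re:
  assumes "re (\<lambda>z. P (pfst z) (pfst (psnd z)) (psnd (psnd z)))"
    and "re (\<lambda>z. N (pfst z) (pfst (psnd z)) (psnd (psnd z)))"
    and D: "\<And>xs. xs \<in> D \<Longrightarrow> \<exists>s m n. xs = [s, m, n] \<and> (P s m n \<longleftrightarrow> Q xs) \<and> (N s m n \<longleftrightarrow> \<not> Q xs)"
  shows "\<exists>p. decides_on p D Q"
proof -
  obtain g h where g: "total_rec g" "\<And>z. P (pfst z) (pfst (psnd z)) (psnd (psnd z)) \<longleftrightarrow> (\<exists>t. g (pair z t) = 0)"
    and h: "total_rec h" "\<And>z. N (pfst z) (pfst (psnd z)) (psnd (psnd z)) \<longleftrightarrow> (\<exists>t. h (pair z t) = 0)"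
    using assms(1,2) unfolding re_def by blast
  obtain pgh where pgh: "\<And>x. evalr pgh [x] (g x * h x)"
    using total_rec_mult[OF g(1) h(1)] unfolding total_rec_def by blast
  obtain pg where pg: "\<And>x. evalr pg [x] (1 - g x)"
    using total_rec_minus[OF total_rec_const g(1)] unfolding total_rec_def by blast
  define search where "search = MinR (Comp pgh [Comp rec_pair [Proj (Suc 0), Proj 0]])"
  define triple where "triple = Comp rec_pair [Proj 0, Comp rec_pair [Proj (Suc 0), Proj (Suc (Suc 0))]]"
  define p where "p = Comp (Comp pg [Comp rec_pair [Proj 0, search]]) [triple]"
  have "evalr p xs (if Q xs then 1 else 0)" if xs_D: "xs \<in> D" for xs
  proof -
    obtain s m n where xs: "xs = [s, m, n]" "P s m n \<longleftrightarrow> Q xs" "N s m n \<longleftrightarrow> \<not> Q xs"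
      using D[OF xs_D] by blast
    define z where "z = pair s (pair m n)"
    have gz: "Q xs \<longleftrightarrow> (\<exists>t. g (pair z t) = 0)" and hz: "\<not> Q xs \<longleftrightarrow> (\<exists>t. h (pair z t) = 0)"
      using g(2)[of z] h(2)[of z] xs(2,3) by (simp_all add: z_def)
    define t where "t = (LEAST t. g (pair z t) * h (pair z t) = 0)"
    have ex: "\<exists>t. g (pair z t) * h (pair z t) = 0" using gz hz by auto
    then have "g (pair z t) * h (pair z t) = 0" unfolding t_def by (rule LeastI_ex)
    \<comment> \<open>Over a fixed \<open>z\<close> only one of \<open>g\<close> and
      \<open>h\<close> has zeros at all, so a zero of the product reveals which.\<close>
    then have "g (pair z t) = 0 \<longleftrightarrow> Q xs" using gz hz by (metis mult_is_0)
    then have eq: "(if Q xs then 1 else 0) = 1 - g (pair z t)" by auto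
    have "evalr search [z] t" unfolding search_def t_def
      by (rule evalr_MinR_Least[OF _ ex]) (intro evalr_Comp1[OF evalr_Comp2[OF evalr_Proj1 evalr_Proj0 evalr_rec_pair] pgh])
    moreover have "evalr triple xs z" unfolding triple_def z_def xs(1)
        by (intro evalr_Comp2[OF _ _ evalr_rec_pair] evalr_Proj0 evalr_Proj1 evalr_Proj2)
    ultimately show ?thesis unfolding p_def eq
      by (intro evalr_Comp1[OF _ evalr_Comp1[OF evalr_Comp2[OF evalr_Proj0 _ evalr_rec_pair] pg]])
  qed
  then show ?thesis unfolding decides_on_def computes_on_def using evalr_functional by blast
qed

section \<open>Ideals, accelerations and closed covers\<close>

text \<open>The candidate for \<open>w(I)\<close>, defined for every set and word; on ideals the
  value \<open>{}\<close> stands for an undefined run of the completion.\<close>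

definition wpost :: "'x ts \<Rightarrow> nat list \<Rightarrow> 'x set \<Rightarrow> 'x set" where
  "wpost S w I = down S (PostSet S I w)"

definition covered :: "'x set set \<Rightarrow> 'x set \<Rightarrow> bool" where
  "covered F I \<longleftrightarrow> (\<exists>K\<in>F. I \<subseteq> K)"

text \<open>The ideals of a Karp-Miller exploration from \<open>x\<close>, where acceleration by any
  word over the alphabet is allowed at every point.\<close>

inductive creach :: "'x ts \<Rightarrow> 'x \<Rightarrow> 'x set \<Rightarrow> bool" for S x where
  creach_init: "creach S x (down S {x})"
| creach_step: "creach S x I \<Longrightarrow> cstep S a I J \<Longrightarrow> creach S x J"
| creach_winf: "creach S x I \<Longrightarrow> set w \<subseteq> alph S \<Longrightarrow> creach S x (winf S w I)"

text \<open>Every letter must lead to a member of \<open>F\<close> itself, not just to an ideal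
  below one. For finite \<open>F\<close> such paths are runs of a finite automaton.\<close>

inductive exact_path :: "'x ts \<Rightarrow> 'x set set \<Rightarrow> 'x set \<Rightarrow> nat list \<Rightarrow> bool" for S F where
  exact_path_Nil: "exact_path S F I []"
| exact_path_Cons: "cstep S a I J \<Longrightarrow> J \<in> F \<Longrightarrow> exact_path S F J v \<Longrightarrow> exact_path S F I (a # v)"

inductive_simps exact_path_Cons_iff: "exact_path S F I (a # v)"

lemma mem_wpost: "z \<in> wpost S w I \<longleftrightarrow> z \<in> states S \<and> (\<exists>x\<in>I. \<exists>y. steps S w x y \<and> ord S z y)"
  by (auto simp: wpost_def down_def PostSet_def Post_def)

lemma wpost_mono: "I \<subseteq> J \<Longrightarrow> wpost S w I \<subseteq> wpost S w J"
  unfolding subset_iff mem_wpost by blast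

lemma wpost_UN: "wpost S w (\<Union>i\<in>A. f i) = (\<Union>i\<in>A. wpost S w (f i))"
  unfolding set_eq_iff UN_iff mem_wpost by blast

inductive_simps steps_Nil_iff: "steps S [] x y"

inductive_simps steps_Cons_iff: "steps S (a # w) x z"

lemma steps_append:
  assumes "steps S u x y" "steps S v y z"
  shows "steps S (u @ v) x z"
  using assms by (induction rule: steps.induct) (auto intro: steps.intros)

text \<open>If each \<open>K\<close> in \<open>F\<close> failed to include some \<open>f k\<close>,
  then at the largest of the chosen indices the sequence would have a member included in no
  \<open>K\<close>.\<close>

lemma covered_Union_increasing:
  assumes "finite F" "\<And>k. covered F (f k)" "\<And>k. f k \<subseteq> f (Suc k)"
  shows "covered F (\<Union>k::nat. f k)"
proof (rule ccontr)
  assume "\<not> covered F (\<Union>k. f k)"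
  then have "\<forall>K\<in>F. \<exists>k. \<not> f k \<subseteq> K" unfolding covered_def by blast
  then obtain k where k: "\<And>K. K \<in> F \<Longrightarrow> \<not> f (k K) \<subseteq> K" by metis
  obtain K where K: "K \<in> F" "f (Max (k ` F)) \<subseteq> K" using assms(2) unfolding covered_def by blast
  have "f (k K) \<subseteq> f (Max (k ` F))"
    by (rule lift_Suc_mono_le[of f, OF assms(3)]) (simp add: K(1) assms(1))
  then show False using k K by blast
qed

section \<open>Ideals and completion steps of a very-WSTS\<close>

locale vwsts =
  fixes S :: "'x ts"
  assumes very: "very_wsts S"
begin

lemma ord_refl: "x \<in> states S \<Longrightarrow> ord S x x"
  using very unfolding very_wsts_def wsts_def wqo_ts_def quasi_order_on_def by blast

lemma ord_trans:
  "x \<in> states S \<Longrightarrow> y \<in> states S \<Longrightarrow> z \<in> states S \<Longrightarrow> ord S x y \<Longrightarrow> ord S y z \<Longrightarrow> ord S x z"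
  using very unfolding very_wsts_def wsts_def wqo_ts_def quasi_order_on_def by blast

lemma finite_alph: "finite (alph S)"
  using very unfolding very_wsts_def wsts_def ts_wf_def by blast

lemma step_wf: "step S a x y \<Longrightarrow> a \<in> alph S \<and> x \<in> states S \<and> y \<in> states S"
  using very unfolding very_wsts_def wsts_def ts_wf_def by blast

lemma steps_wf: "steps S w x y \<Longrightarrow> set w \<subseteq> alph S \<and> x \<in> states S \<and> y \<in> states S"
  by (induction rule: steps.induct) (auto dest: step_wf)

lemma step_mono:
  "step S a x y \<Longrightarrow> x' \<in> states S \<Longrightarrow> ord S x x' \<Longrightarrow> \<exists>y'. step S a x' y' \<and> ord S y y'"
  using very unfolding very_wsts_def strong_mono_def by blast

lemma steps_mono:
  assumes "steps S w x y" "x' \<in> states S" "ord S x x'"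
  shows "\<exists>y'. steps S w x' y' \<and> ord S y y'"
  using assms
proof (induction arbitrary: x' rule: steps.induct)
  case (steps_cons a x y w z)
  then obtain y' where y': "step S a x' y'" "ord S y y'" using step_mono by blast
  then have "y' \<in> states S" using step_wf by blast
  then show ?case using steps_cons.IH y' by (meson steps.steps_cons)
qed (auto intro: steps.intros)

lemma Idl_iff:
  "I \<in> Idl S \<longleftrightarrow> I \<subseteq> states S \<and> I \<noteq> {} \<and> (\<forall>x\<in>I. \<forall>y\<in>states S. ord S y x \<longrightarrow> y \<in> I) \<and> directed_in S I"
  unfolding Idl_def down_def using ord_refl by blast

lemma Idl_states: "I \<in> Idl S \<Longrightarrow> I \<subseteq> states S"
  and Idl_nonempty: "I \<in> Idl S \<Longrightarrow> I \<noteq> {}"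
  and Idl_down: "I \<in> Idl S \<Longrightarrow> x \<in> I \<Longrightarrow> y \<in> states S \<Longrightarrow> ord S y x \<Longrightarrow> y \<in> I"
  by (simp_all add: Idl_iff)

lemma Idl_directed:
  "I \<in> Idl S \<Longrightarrow> x \<in> I \<Longrightarrow> y \<in> I \<Longrightarrow> \<exists>z\<in>I. ord S x z \<and> ord S y z"
  unfolding Idl_iff directed_in_def by blast

lemma down_single_Idl: "x \<in> states S \<Longrightarrow> down S {x} \<in> Idl S"
  unfolding Idl_iff down_def directed_in_def using ord_refl ord_trans by blast

lemma Union_chain_Idl:
  assumes "C \<noteq> {}" "C \<subseteq> Idl S" "\<And>I J. I \<in> C \<Longrightarrow> J \<in> C \<Longrightarrow> I \<subseteq> J \<or> J \<subseteq> I"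
  shows "\<Union>C \<in> Idl S"
proof -
  have "directed_in S (\<Union>C)" unfolding directed_in_def
  proof (intro ballI)
    fix x y assume "x \<in> \<Union>C" "y \<in> \<Union>C"
    then obtain I where "I \<in> C" "x \<in> I" "y \<in> I" using assms(3) by blast
    then show "\<exists>z\<in>\<Union>C. ord S x z \<and> ord S y z" using Idl_directed assms(2) by blast
  qed
  moreover have "\<Union>C \<subseteq> states S" using assms(2) Idl_states by blast
  moreover have "\<Union>C \<noteq> {}" using assms(1,2) Idl_nonempty by blast
  moreover have "\<forall>x\<in>\<Union>C. \<forall>y\<in>states S. ord S y x \<longrightarrow> y \<in> \<Union>C" using assms(2) Idl_down by blast
  ultimately show ?thesis unfolding Idl_iff by blast
qed

lemma Union_increasing_Idl:
  assumes "\<And>k. f k \<in> Idl S" "\<And>k. f k \<subseteq> f (Suc k)"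
  shows "(\<Union>k::nat. f k) \<in> Idl S"
proof (rule Union_chain_Idl)
  have "i \<le> j \<Longrightarrow> f i \<subseteq> f j" for i j using assms(2) by (rule lift_Suc_mono_le)
  then show "I \<subseteq> J \<or> J \<subseteq> I" if "I \<in> range f" "J \<in> range f" for I J
    using that by (auto, metis nat_le_linear subsetD)
qed (use assms(1) in auto)

lemma wpost_Nil:
  assumes "I \<in> Idl S"
  shows "wpost S [] I = I"
  using assms ord_refl unfolding Idl_iff set_eq_iff mem_wpost steps_Nil_iff by (simp, blast)

text \<open>Closing downwards between \<open>u\<close> and \<open>v\<close> adds nothing: by strong
  monotonicity a run of \<open>v\<close> from a smaller state can be imitated from the larger
  one.\<close>

lemma wpost_append:
  assumes "I \<subseteq> states S"
  shows "wpost S (u @ v) I = wpost S v (wpost S u I)"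
proof (intro set_eqI iffI)
  fix z assume "z \<in> wpost S (u @ v) I"
  then obtain x y where z: "z \<in> states S" "x \<in> I" "steps S (u @ v) x y" "ord S z y"
    by (auto simp: mem_wpost)
  have "\<exists>x'. steps S u x x' \<and> steps S v x' y" using z(3)
  proof (induction u arbitrary: x)
    case Nil
    then show ?case using steps_wf steps_nil by (metis append_Nil)
  next
    case (Cons a u)
    then obtain x1 where "step S a x x1" "steps S (u @ v) x1 y" by (auto elim: steps.cases)
    then show ?case using Cons.IH by (meson steps_cons)
  qed
  then obtain x' where x': "steps S u x x'" "steps S v x' y" by blast
  then have "x' \<in> wpost S u I" using z(2) steps_wf ord_refl unfolding mem_wpost by blast
  then show "z \<in> wpost S v (wpost S u I)" using z x' unfolding mem_wpost[of z] by blast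
next
  fix z assume "z \<in> wpost S v (wpost S u I)"
  then obtain x y y' t where *: "z \<in> states S" "x \<in> I" "steps S u x y" "y' \<in> states S" "ord S y' y"
    "steps S v y' t" "ord S z t" by (auto simp: mem_wpost)
  then obtain t' where "steps S v y t'" "ord S t t'" using steps_mono steps_wf by meson
  then show "z \<in> wpost S (u @ v) I" unfolding mem_wpost
    using * steps_append steps_wf ord_trans by meson
qed

lemma cstep_maximal_exists:
  assumes "a \<in> alph S" "I \<in> Idl S" "z \<in> wpost S [a] I"
  shows "\<exists>M. cstep S a I M \<and> z \<in> M"
proof -
  define A where "A = {K \<in> Idl S. K \<subseteq> wpost S [a] I \<and> z \<in> K}"
  have z: "z \<in> states S" using assms by (simp add: mem_wpost)
  have "down S {z} \<in> A"
  proof -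
    have "down S {z} \<subseteq> wpost S [a] I"
    proof
      fix t assume "t \<in> down S {z}"
      then have "t \<in> states S" "ord S t z" by (auto simp: down_def)
      then show "t \<in> wpost S [a] I" using assms(3) ord_trans steps_wf unfolding mem_wpost by meson
    qed
    then show ?thesis using down_single_Idl[OF z] ord_refl[OF z] z by (auto simp: A_def down_def)
  qed
  moreover have "\<Union>C \<in> A" if "C \<noteq> {}" "subset.chain A C" for C
  proof -
    have "C \<subseteq> A" "\<And>I J. I \<in> C \<Longrightarrow> J \<in> C \<Longrightarrow> I \<subseteq> J \<or> J \<subseteq> I"
      using that(2) by (auto simp: subset_chain_def)
    then show ?thesis using that(1) Union_chain_Idl[of C] unfolding A_def by blast
  qed
  ultimately obtain M where "M \<in> A" "\<forall>X\<in>A. M \<subseteq> X \<longrightarrow> X = M"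
    using subset_Zorn_nonempty[of A] by blast
  \<comment> \<open>Maximality within \<open>A\<close> is maximality among all ideals in the
    closure, since every ideal above \<open>M\<close> still contains \<open>z\<close>.\<close>
  then show ?thesis using assms(1,2) unfolding A_def cstep_def wpost_def by blast
qed

lemma cstep_functional: "cstep S a I J \<Longrightarrow> cstep S a I K \<Longrightarrow> J = K"
  using very unfolding very_wsts_def deterministic_def completion_def by auto

text \<open>By Zorn's lemma every element of the downward closure of the successors lies in a maximal
  ideal, so determinism makes that closure itself the unique completion successor.\<close>

lemma cstep_iff: "cstep S a I J \<longleftrightarrow> I \<in> Idl S \<and> J = wpost S [a] I \<and> J \<noteq> {}"
proof -
  have eq: "J = wpost S [a] I \<and> J \<noteq> {} \<and> I \<in> Idl S" if "cstep S a I J" for J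
  proof -
    have "a \<in> alph S" "I \<in> Idl S" "J \<in> Idl S" "J \<subseteq> wpost S [a] I"
      using that unfolding cstep_def wpost_def by auto
    moreover have "wpost S [a] I \<subseteq> J" using calculation cstep_maximal_exists cstep_functional that by blast
    ultimately show ?thesis unfolding Idl_iff by blast
  qed
  moreover have "cstep S a I (wpost S [a] I)" if I: "I \<in> Idl S" "wpost S [a] I \<noteq> {}"
  proof -
    obtain z where z: "z \<in> wpost S [a] I" using I(2) by blast
    then obtain x y where "steps S [a] x y" by (auto simp: mem_wpost)
    then have "a \<in> alph S" using steps_wf by fastforce
    then show ?thesis using cstep_maximal_exists[OF _ I(1) z] eq by metis
  qed
  ultimately show ?thesis by blast
qed

lemma completion_simps [simp]:
  "states (completion S) = Idl S" "step (completion S) = cstep S" "ord (completion S) = (\<subseteq>)"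
  by (simp_all add: completion_def)

lemma cstep_Idl: "cstep S a I J \<Longrightarrow> I \<in> Idl S \<and> J \<in> Idl S"
  unfolding cstep_def by blast

lemma wpost_Cons: "I \<in> Idl S \<Longrightarrow> wpost S (a # w) I = wpost S w (wpost S [a] I)"
  using wpost_append[of I "[a]" w] unfolding Idl_iff by simp

lemma wpost_empty [simp]: "wpost S w {} = {}"
  by (auto simp: mem_wpost)

text \<open>One nonemptiness condition on the result suffices: the empty set has empty image, so an
  undefined step is never recovered from.\<close>

lemma csteps_iff: "steps (completion S) w I J \<longleftrightarrow> I \<in> Idl S \<and> J = wpost S w I \<and> J \<noteq> {}"
proof (induction w arbitrary: I)
  case Nil
  have "I \<in> Idl S \<Longrightarrow> I \<noteq> {}" unfolding Idl_iff by blast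
  then show ?case using wpost_Nil steps_nil[of _ "completion S"] by (auto elim: steps.cases)
next
  case (Cons a w)
  have "steps (completion S) (a # w) I J \<longleftrightarrow> (\<exists>K. cstep S a I K \<and> steps (completion S) w K J)"
    by (simp add: steps_Cons_iff)
  also have "\<dots> \<longleftrightarrow> I \<in> Idl S \<and> J = wpost S (a # w) I \<and> J \<noteq> {}"
    unfolding Cons using cstep_iff cstep_Idl wpost_Cons wpost_empty by metis
  finally show ?case .
qed

lemma wpost_Idl:
  assumes "I \<in> Idl S" "wpost S w I \<noteq> {}"
  shows "wpost S w I \<in> Idl S"
proof -
  have "steps (completion S) w I J \<Longrightarrow> J \<in> Idl S" for J
    by (induction rule: steps.induct) auto
  then show ?thesis using assms csteps_iff by blast
qed

lemma wpost_letter_strict: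
  assumes "I \<in> Idl S" "J \<in> Idl S" "I \<subset> J" "wpost S [a] I \<noteq> {}"
  shows "wpost S [a] I \<subset> wpost S [a] J"
proof -
  have "strong_strict_mono (completion S)" using very unfolding very_wsts_def by blast
  moreover have "cstep S a I (wpost S [a] I)" using assms cstep_iff by blast
  moreover have "less_ts (completion S) I J" using assms(3) by (auto simp: less_ts_def)
  ultimately obtain K where "cstep S a J K" "less_ts (completion S) (wpost S [a] I) K"
    using assms(2,3) unfolding strong_strict_mono_def completion_simps by blast
  then show ?thesis using cstep_iff by (auto simp: less_ts_def)
qed

lemma wpost_strict:
  assumes "I \<in> Idl S" "J \<in> Idl S" "I \<subset> J" "wpost S w I \<noteq> {}"
  shows "wpost S w I \<subset> wpost S w J"
  using assms
proof (induction w arbitrary: I J)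
  case Nil
  then show ?case by (simp add: wpost_Nil)
next
  case (Cons a w)
  have ne: "wpost S [a] I \<noteq> {}" using Cons.prems wpost_Cons wpost_empty by metis
  then have "wpost S [a] I \<subset> wpost S [a] J" using wpost_letter_strict Cons.prems by blast
  moreover have "wpost S [a] I \<in> Idl S" "wpost S [a] J \<in> Idl S"
    using ne calculation wpost_Idl Cons.prems by auto
  ultimately show ?case using Cons.IH Cons.prems wpost_Cons by metis
qed

section \<open>Accelerations and levels\<close>

lemma cword_eq:
  "I \<in> Idl S \<Longrightarrow> cword S w I = (if wpost S w I = {} then None else Some (wpost S w I))"
  unfolding cword_def csteps_iff by (auto intro!: the_equality)

text \<open>Applying \<open>w\<close> to a strict inclusion between ideals with nonempty images
  gives a strict inclusion again. Hence all iterates are defined and strictly increasing, as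
  membership in the next level requires.\<close>

lemma wpost_power:
  assumes "I \<in> Idl S" "I \<subset> wpost S w I"
  shows "(wpost S w ^^ k) I \<in> Idl S \<and> (wpost S w ^^ k) I \<subset> (wpost S w ^^ Suc k) I
    \<and> cword_pow S w k I = Some ((wpost S w ^^ k) I)"
proof (induction k)
  case 0
  then show ?case using assms by simp
next
  case (Suc k)
  let ?J = "(wpost S w ^^ k) I"
  have J: "?J \<in> Idl S" "?J \<subset> wpost S w ?J" using Suc by auto
  then have "wpost S w ?J \<in> Idl S" using wpost_Idl by auto
  moreover have "wpost S w ?J \<subset> wpost S w (wpost S w ?J)"
    using wpost_strict[OF J(1) calculation J(2)] J(2) by blast
  moreover have "cword S w ?J = Some (wpost S w ?J)" using cword_eq[OF J(1)] J(2) by auto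
  ultimately show ?case using Suc by simp
qed

lemma winf_strict:
  assumes "I \<in> Idl S" "I \<subset> wpost S w I"
  shows "winf S w I = (\<Union>k. (wpost S w ^^ k) I)"
proof -
  have "cword S w I = Some (wpost S w I)" using cword_eq[OF assms(1)] assms(2) by auto
  then have "winf S w I = \<Union>{J. \<exists>k. cword_pow S w k I = Some J}"
    unfolding winf_def using assms(2) by auto
  then show ?thesis using wpost_power[OF assms] by auto
qed

lemma winf_not_strict: "I \<in> Idl S \<Longrightarrow> \<not> I \<subset> wpost S w I \<Longrightarrow> winf S w I = I"
  unfolding winf_def using cword_eq by (auto split: if_splits)

lemma wpost_subset_winf:
  assumes "I \<in> Idl S" "I \<subset> wpost S w I"
  shows "wpost S w I \<subseteq> winf S w I"
proof -
  have "(wpost S w ^^ 1) I \<subseteq> winf S w I" unfolding winf_strict[OF assms] by blast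
  then show ?thesis by simp
qed

lemma winf_Idl:
  assumes "I \<in> Idl S"
  shows "winf S w I \<in> Idl S"
proof (cases "I \<subset> wpost S w I")
  case True
  show ?thesis unfolding winf_strict[OF assms True]
    using wpost_power[OF assms True] by (intro Union_increasing_Idl) blast+
qed (simp add: winf_not_strict assms)

lemma Idl_level_subset: "Idl_level S (Suc n) \<subseteq> Idl_level S n"
proof (induction n)
  case 0
  show ?case
  proof
    fix I assume "I \<in> Idl_level S (Suc 0)"
    then obtain f where "I = (\<Union>k. f k)" "\<And>k. f k \<in> Idl S" "\<And>k. f k \<subset> f (Suc k)" by auto
    then show "I \<in> Idl_level S 0" using Union_increasing_Idl[of f] by auto
  qed
next
  case (Suc n)
  show ?case
  proof
    fix I assume "I \<in> Idl_level S (Suc (Suc n))"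
    then obtain f where "I = \<Union>(range f)" "\<And>k. f k \<in> Idl_level S (Suc n)" "\<And>k. f k \<subset> f (Suc k)"
      unfolding Idl_level.simps(2)[of S "Suc n"] by blast
    moreover from this have "\<And>k. f k \<in> Idl_level S n" using Suc by blast
    ultimately show "I \<in> Idl_level S (Suc n)" by auto
  qed
qed

lemma Idl_level_Idl: "I \<in> Idl_level S n \<Longrightarrow> I \<in> Idl S"
  using Idl_level_subset by (induction n) auto

text \<open>Images commute with unions and preserve strict inclusion once they are nonempty, so a
  strictly increasing sequence is sent to another one.\<close>

lemma wpost_Idl_level:
  assumes "I \<in> Idl_level S n" "wpost S w I \<noteq> {}"
  shows "wpost S w I \<in> Idl_level S n"
  using assms
proof (induction n arbitrary: I)
  case 0
  then show ?case using wpost_Idl by simp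
next
  case (Suc n)
  then obtain f where f: "I = (\<Union>k. f k)" "\<And>k. f k \<in> Idl_level S n" "\<And>k. f k \<subset> f (Suc k)" by auto
  have I: "wpost S w I = (\<Union>k. wpost S w (f k))" unfolding f(1) by (rule wpost_UN)
  then obtain m where m: "wpost S w (f m) \<noteq> {}" using Suc.prems by auto
  \<comment> \<open>Early members may have empty images; starting at \<open>m\<close> avoids them
    and keeps the union, because the sequence increases.\<close>
  define g where "g k = wpost S w (f (m + k))" for k
  have mono: "i \<le> j \<Longrightarrow> f i \<subseteq> f j" for i j
    by (rule lift_Suc_mono_le[of f]) (use f(3) in blast)
  have ne: "g k \<noteq> {}" for k
    using m wpost_mono[OF mono[of m "m + k"], of S w] unfolding g_def by auto
  have "g k \<in> Idl_level S n" for k unfolding g_def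
    by (rule Suc.IH[OF f(2)]) (use ne in \<open>simp add: g_def\<close>)
  moreover have "g k \<subset> g (Suc k)" for k unfolding g_def add_Suc_right
    by (rule wpost_strict[OF Idl_level_Idl[OF f(2)] Idl_level_Idl[OF f(2)] f(3)])
      (use ne in \<open>simp add: g_def\<close>)
  moreover have "wpost S w I = (\<Union>k. g k)"
  proof -
    have "wpost S w (f k) \<subseteq> g k" for k unfolding g_def by (rule wpost_mono[OF mono]) simp
    then show ?thesis unfolding I g_def by blast
  qed
  ultimately show ?case unfolding Idl_level.simps by blast
qed

text \<open>The iterates stay in the level of \<open>I\<close> and increase strictly, so their union
  lies one level further. This bounds the nesting of proper accelerations.\<close>

lemma winf_Idl_level:
  assumes "I \<in> Idl_level S n" "I \<subset> wpost S w I"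
  shows "winf S w I \<in> Idl_level S (Suc n)"
proof -
  have I: "I \<in> Idl S" using assms Idl_level_Idl by blast
  have "(wpost S w ^^ k) I \<in> Idl_level S n" for k
  proof (induction k)
    case (Suc k)
    then show ?case using wpost_Idl_level[OF Suc, of w] wpost_power[OF I assms(2), of k] by auto
  qed (use assms in simp)
  moreover have "(wpost S w ^^ k) I \<subset> (wpost S w ^^ Suc k) I" for k
    using wpost_power[OF I assms(2)] by blast
  ultimately show ?thesis
    unfolding Idl_level.simps winf_strict[OF I assms(2)] mem_Collect_eq
    by (intro exI[of _ "\<lambda>k. (wpost S w ^^ k) I"]) blast
qed

section \<open>Reachable ideals and finite closed covers\<close>

lemma creach_Idl: "x \<in> states S \<Longrightarrow> creach S x I \<Longrightarrow> I \<in> Idl S"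
  by (rotate_tac, induction rule: creach.induct) (auto simp: down_single_Idl winf_Idl dest: cstep_Idl)

lemma creach_wpost:
  assumes "x \<in> states S" "creach S x I" "wpost S w I \<noteq> {}"
  shows "creach S x (wpost S w I)"
  using assms(2,3)
proof (induction w arbitrary: I)
  case Nil
  then show ?case using wpost_Nil creach_Idl[OF assms(1)] by simp
next
  case (Cons a w)
  have I: "I \<in> Idl S" using Cons creach_Idl[OF assms(1)] by blast
  then have "wpost S [a] I \<noteq> {}" using Cons wpost_Cons wpost_empty by metis
  then have "creach S x (wpost S [a] I)" using I Cons.prems(1) creach_step cstep_iff by metis
  then show ?case using Cons.IH Cons.prems(2) wpost_Cons[OF I] by metis
qed

lemma wpost_below_reachable:
  assumes "\<And>z. z \<in> I \<Longrightarrow> \<exists>u z'. steps S u x z' \<and> ord S z z'" "z \<in> wpost S w I"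
  shows "\<exists>u z'. steps S u x z' \<and> ord S z z'"
proof -
  obtain t t' where t: "z \<in> states S" "t \<in> I" "steps S w t t'" "ord S z t'"
    using assms(2) unfolding mem_wpost by blast
  obtain u r where r: "steps S u x r" "ord S t r" using assms(1) t(2) by blast
  then obtain r' where "steps S w r r'" "ord S t' r'" using steps_mono[OF t(3)] steps_wf by blast
  then show ?thesis using t r steps_append ord_trans[of z t' r'] steps_wf by meson
qed

text \<open>Accelerations add nothing spurious: an element of an accelerated ideal already lies in a
  finite iterate, and covering runs extend by monotonicity.\<close>

lemma creach_sound:
  assumes "x \<in> states S" "creach S x I" "z \<in> I"
  shows "\<exists>u z'. steps S u x z' \<and> ord S z z'"
  using assms(2,3)
proof (induction arbitrary: z rule: creach.induct)
  case creach_init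
  then show ?case using assms(1) steps_nil by (fastforce simp: down_def)
next
  case (creach_step I a J)
  then show ?case using wpost_below_reachable[of I x z "[a]"] cstep_iff by simp
next
  case (creach_winf I w)
  have I: "I \<in> Idl S" using creach_winf creach_Idl assms(1) by blast
  show ?case
  proof (cases "I \<subset> wpost S w I")
    case True
    have "z \<in> (wpost S w ^^ k) I \<Longrightarrow> \<exists>u z'. steps S u x z' \<and> ord S z z'" for k z
    proof (induction k arbitrary: z)
      case (Suc k)
      then show ?case using wpost_below_reachable[of "(wpost S w ^^ k) I" x z w] by simp
    qed (use creach_winf in simp)
    then show ?thesis using creach_winf.prems unfolding winf_strict[OF I True] by blast
  next
    case False
    then show ?thesis using creach_winf winf_not_strict[OF I False] by simp
  qed
qed

text \<open>\<open>F\<close> covers the Karp--Miller subtree rooted at \<open>I\<close>, relative to the ancestors \<open>anc\<close> of that node: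
  a branch may stop as soon as it falls below an ancestor.\<close>

definition cover_mod :: "'x \<Rightarrow> 'x set list \<Rightarrow> 'x set \<Rightarrow> 'x set set \<Rightarrow> bool" where
  "cover_mod x anc I F \<longleftrightarrow> finite F \<and> F \<subseteq> Collect (creach S x) \<and> covered (F \<union> set anc) I \<and>
     (\<forall>K\<in>F. \<forall>a. wpost S [a] K \<noteq> {} \<longrightarrow> covered (F \<union> set anc) (wpost S [a] K))"

text \<open>The covers of the children together with \<open>I\<close> itself serve for
  \<open>I\<close>: a branch that stopped below the ancestor \<open>I\<close> now stops below a
  member of the set. Finiteness comes from the finite alphabet.\<close>

lemma cover_mod_children:
  assumes "creach S x I"
    and "\<And>a. wpost S [a] I \<noteq> {} \<Longrightarrow> \<exists>F. cover_mod x (I # anc) (wpost S [a] I) F"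
  shows "\<exists>F. cover_mod x anc I F"
proof -
  obtain G where G: "\<And>a. wpost S [a] I \<noteq> {} \<Longrightarrow> cover_mod x (I # anc) (wpost S [a] I) (G a)"
    using assms(2) by metis
  define B where "B = {a. wpost S [a] I \<noteq> {}}"
  have "B \<subseteq> alph S" using steps_wf by (fastforce simp: B_def mem_wpost)
  then have "finite B" using finite_alph finite_subset by blast
  define F where "F = insert I (\<Union>a\<in>B. G a)"
  have sub: "covered (G a \<union> set (I # anc)) K \<Longrightarrow> covered (F \<union> set anc) K" if "a \<in> B" for a K
    using that unfolding covered_def F_def by auto
  have "finite F" using \<open>finite B\<close> G unfolding F_def B_def cover_mod_def by auto
  moreover have "F \<subseteq> Collect (creach S x)"
    using assms(1) G unfolding F_def B_def cover_mod_def by blast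
  moreover have "covered (F \<union> set anc) I" unfolding covered_def F_def by auto
  moreover have "covered (F \<union> set anc) (wpost S [b] K)" if K: "K \<in> F" "wpost S [b] K \<noteq> {}" for K b
  proof (cases "K = I")
    case True
    then show ?thesis using K(2) G[of b] sub[of b] unfolding cover_mod_def B_def by blast
  next
    case False
    then obtain a where a: "a \<in> B" "K \<in> G a" using K(1) unfolding F_def by blast
    then have "cover_mod x (I # anc) (wpost S [a] I) (G a)" using G unfolding B_def by blast
    then have "covered (G a \<union> set (I # anc)) (wpost S [b] K)"
      using a(2) K(2) unfolding cover_mod_def by blast
    then show ?thesis using sub a(1) by blast
  qed
  ultimately show ?thesis unfolding cover_mod_def by blast
qed

text \<open>Induction downwards from an empty level. A node without a cover would start an infinite
  branch of such nodes, where the wqo on ideals gives an ancestor \<open>K\<close> below a later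
  \<open>I\<close>. If they are equal, the branch stops; otherwise accelerating \<open>K\<close>
  reaches the next level, and the cover obtained there also covers \<open>I\<close>.\<close>

lemma closed_cover_level:
  assumes x: "x \<in> states S" and N: "Idl_level S N = {}" and "n \<le> N"
  shows "\<forall>I. creach S x I \<and> I \<in> Idl_level S n \<longrightarrow> (\<exists>F. cover_mod x [] I F)"
  using \<open>n \<le> N\<close>
proof (induction rule: inc_induct)
  case base
  then show ?case using N by simp
next
  case (step n)
  \<comment> \<open>A node \<open>I\<close> without a cover, together with ancestors from each of
    which some word leads to \<open>I\<close>.\<close>
  define Inv where "Inv p \<longleftrightarrow> (case p of (anc, I) \<Rightarrow> creach S x I \<and> I \<in> Idl_level S n \<and>
     (\<nexists>F. cover_mod x anc I F) \<and>
     (\<forall>K\<in>set anc. creach S x K \<and> K \<in> Idl_level S n \<and> (\<exists>w. I = wpost S w K)))" for p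
  have not_above: "\<not> K \<subseteq> I" if Inv: "Inv (anc, I)" and K: "K \<in> set anc" for anc I K
  proof
    assume "K \<subseteq> I"
    moreover have "K \<noteq> I"
    proof
      assume "K = I"
      \<comment> \<open>The branch may stop at once, so even the empty set is a cover relative to
        the ancestors.\<close>
      then have "cover_mod x anc I {}" using K unfolding cover_mod_def covered_def by auto
      then show False using Inv unfolding Inv_def by auto
    qed
    moreover obtain w where w: "I = wpost S w K" and KR: "creach S x K" "K \<in> Idl_level S n"
      using Inv K unfolding Inv_def by auto
    ultimately have str: "K \<subset> wpost S w K" by blast
    then obtain z where "z \<in> wpost S w K" by blast
    then have "set w \<subseteq> alph S" using steps_wf unfolding mem_wpost by blast
    with KR(1) have "creach S x (winf S w K)" by (rule creach_winf)
    moreover have "winf S w K \<in> Idl_level S (Suc n)" by (rule winf_Idl_level[OF KR(2) str])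
    \<comment> \<open>This cover has an empty ancestor list, so it stays valid under any ancestors,
      and it covers \<open>I\<close> because \<open>I\<close> lies in the accelerated ideal.\<close>
    ultimately obtain F where F: "cover_mod x [] (winf S w K) F" using step.IH by blast
    have sub: "covered (F \<union> set []) J \<Longrightarrow> covered (F \<union> set anc) J" for J
      unfolding covered_def by auto
    have "I \<subseteq> winf S w K" using wpost_subset_winf[OF Idl_level_Idl[OF KR(2)] str] w by simp
    moreover have "covered F (winf S w K)" using F unfolding cover_mod_def by simp
    ultimately have "covered (F \<union> set anc) I" unfolding covered_def by blast
    then have "cover_mod x anc I F" using F sub unfolding cover_mod_def by blast
    then show False using Inv unfolding Inv_def by auto
  qed
  have extend: "\<exists>J. Inv (I # anc, J)" if Inv: "Inv (anc, I)" for anc I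
  proof -
    have I: "creach S x I" "I \<in> Idl_level S n" "\<nexists>F. cover_mod x anc I F"
      using Inv unfolding Inv_def by auto
    then obtain a where a: "wpost S [a] I \<noteq> {}" "\<nexists>F. cover_mod x (I # anc) (wpost S [a] I) F"
      using cover_mod_children by blast
    have "\<exists>w. wpost S [a] I = wpost S w K" if K: "K \<in> set anc" for K
    proof -
      obtain w where "I = wpost S w K" "K \<in> Idl S"
        using Inv K Idl_level_Idl unfolding Inv_def by auto
      then show ?thesis using wpost_append[OF Idl_states, of K w "[a]"] by metis
    qed
    then have "Inv (I # anc, wpost S [a] I)"
      using Inv I a(2) creach_wpost[OF x I(1) a(1)] wpost_Idl_level[OF I(2) a(1)]
      unfolding Inv_def by auto
    then show ?thesis by blast
  qed
  show ?case
  proof (intro allI impI, rule ccontr)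
    fix I assume "creach S x I \<and> I \<in> Idl_level S n" "\<nexists>F. cover_mod x [] I F"
    then have "Inv ([], I)" unfolding Inv_def by auto
    moreover have "\<exists>q. Inv q \<and> fst q = snd p # fst p" if p: "Inv p" for p
    proof -
      obtain J where "Inv (snd p # fst p, J)" using extend[of "fst p" "snd p"] p by auto
      then show ?thesis by (intro exI[of _ "(snd p # fst p, J)"]) simp
    qed
    ultimately obtain f where f: "\<And>i. Inv (f i)" "\<And>i. fst (f (Suc i)) = snd (f i) # fst (f i)"
      using dependent_nat_choice[of "\<lambda>_. Inv" "\<lambda>_ p q. fst q = snd p # fst p"] by metis
    have mem: "i < j \<Longrightarrow> snd (f i) \<in> set (fst (f j))" for i j
      by (induction j) (auto simp: f(2) less_Suc_eq)
    have "snd (f i) \<in> Idl S" for i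
      using f(1)[of i] Idl_level_Idl unfolding Inv_def by (auto split: prod.splits)
    moreover have "wqo_ts (completion S)" using very unfolding very_wsts_def wsts_def by blast
    ultimately obtain i j where "i < j" "snd (f i) \<subseteq> snd (f j)"
      unfolding wqo_ts_def completion_simps by (auto dest!: spec[of _ "\<lambda>i. snd (f i)"])
    then show False using not_above[of "fst (f j)" "snd (f j)"] f(1) mem by auto
  qed
qed

text \<open>Closure is demanded for single steps only, so finitely many inclusion tests confirm it.
  That accelerations are dominated as well is a consequence.\<close>

definition closed_cover :: "'x \<Rightarrow> 'x set set \<Rightarrow> bool" where
  "closed_cover x F \<longleftrightarrow> finite F \<and> F \<subseteq> Collect (creach S x) \<and> covered F (down S {x}) \<and>
     (\<forall>K\<in>F. \<forall>a. wpost S [a] K \<noteq> {} \<longrightarrow> covered F (wpost S [a] K))"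

lemma closed_cover_exists:
  assumes "x \<in> states S"
  shows "\<exists>F. closed_cover x F"
proof -
  obtain N where "Idl_level S N = {}"
    using very unfolding very_wsts_def finitely_many_levels_def by blast
  then show ?thesis using closed_cover_level[OF assms, of N 0] creach_init down_single_Idl[OF assms]
    unfolding closed_cover_def cover_mod_def by fastforce
qed

lemma closed_cover_wpost:
  assumes "closed_cover x F" "x \<in> states S" "covered F I" "I \<in> Idl S" "wpost S w I \<noteq> {}"
  shows "covered F (wpost S w I)"
  using assms(3-5)
proof (induction w arbitrary: I)
  case Nil
  then show ?case by (simp add: wpost_Nil)
next
  case (Cons a w)
  have ne: "wpost S [a] I \<noteq> {}" using Cons.prems wpost_Cons wpost_empty by metis
  obtain K where K: "K \<in> F" "I \<subseteq> K" using Cons.prems unfolding covered_def by blast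
  have "wpost S [a] I \<subseteq> wpost S [a] K" using wpost_mono[OF K(2)] .
  moreover have "covered F (wpost S [a] K)"
    using assms(1) K(1) calculation ne unfolding closed_cover_def by blast
  ultimately have "covered F (wpost S [a] I)" unfolding covered_def by blast
  then show ?case using Cons.IH Cons.prems(2,3) ne wpost_Idl wpost_Cons by metis
qed

text \<open>In the case of an acceleration the iterates are covered one by one, and by finiteness a
  single member of \<open>F\<close> then covers their union.\<close>

lemma closed_cover_covers:
  assumes "closed_cover x F" "x \<in> states S" "creach S x I"
  shows "covered F I"
  using assms(3)
proof (induction rule: creach.induct)
  case creach_init
  show ?case using assms(1) unfolding closed_cover_def by blast
next
  case (creach_step I a J)
  then show ?case using closed_cover_wpost[OF assms(1,2), of I "[a]"] cstep_iff[of a I J] by blast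
next
  case (creach_winf I w)
  have I: "I \<in> Idl S" using creach_Idl[OF assms(2) creach_winf.hyps(1)] .
  show ?case
  proof (cases "I \<subset> wpost S w I")
    case True
    have "covered F ((wpost S w ^^ k) I)" for k
    proof (induction k)
      case (Suc k)
      show ?case
        using closed_cover_wpost[OF assms(1,2) Suc, of w] wpost_power[OF I True, of k] by auto
    qed (use creach_winf in simp)
    moreover have "finite F" using assms(1) unfolding closed_cover_def by blast
    ultimately show ?thesis unfolding winf_strict[OF I True]
      using wpost_power[OF I True] by (intro covered_Union_increasing) blast+
  next
    case False
    then show ?thesis using creach_winf winf_not_strict[OF I False] by simp
  qed
qed

section \<open>Repeated coverability through exact paths\<close>

lemma exact_path_wpost_nonempty: "exact_path S F I v \<Longrightarrow> I \<in> Idl S \<Longrightarrow> wpost S v I \<noteq> {}"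
proof (induction rule: exact_path.induct)
  case (exact_path_Nil I)
  then show ?case using wpost_Nil Idl_iff by auto
next
  case (exact_path_Cons a I J v)
  then show ?case using wpost_Cons cstep_Idl cstep_iff by metis
qed

text \<open>Directedness gives a \<open>z\<close> in \<open>I\<close> above both \<open>y\<close>
  and a state enabling \<open>v\<close>. A reachable state above \<open>z\<close> admits
  \<open>v\<close> forever, since each run of the positive word can be chosen to end above its
  start.\<close>

lemma rep_coverable_if_positive_enabled:
  assumes x: "x \<in> states S" "y \<in> states S"
    and I: "creach S x I" "y \<in> I" and v: "v \<noteq> []" "positive_word S v" "wpost S v I \<noteq> {}"
  shows "rep_coverable S x y"
proof -
  obtain z0 z1 where z0: "z0 \<in> I" "steps S v z0 z1" using v(3) by (auto simp: mem_wpost)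
  obtain z where z: "z \<in> I" "ord S y z" "ord S z0 z"
    using Idl_directed creach_Idl x(1) I z0(1) by meson
  obtain u z' where z': "steps S u x z'" "ord S z z'" using creach_sound[OF x(1) I(1) z(1)] by blast
  have st: "z \<in> states S" "z' \<in> states S" "z0 \<in> states S"
    using z' z0 steps_wf z(1) creach_Idl[OF x(1) I(1)] Idl_iff by auto
  define Q where "Q t \<longleftrightarrow> t \<in> states S \<and> ord S y t \<and> Post S t v \<noteq> {}" for t
  have "ord S y z'" "ord S z0 z'" using st x z z' ord_trans by blast+
  then have "Q z'" using steps_mono[OF z0(2)] st unfolding Q_def Post_def by blast
  moreover have "\<exists>t'. Q t' \<and> steps S v t t'" if t: "Q t" for t
  proof -
    obtain t' where t': "steps S v t t'" "ord S t t'"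
      using t v(2) unfolding Q_def positive_word_def positive_for_def by blast
    moreover have t'S: "t' \<in> states S" using steps_wf[OF t'(1)] by blast
    moreover obtain t'' where "steps S v t' t''" using steps_mono[OF t'(1) t'S t'(2)] by blast
    ultimately show ?thesis using t ord_trans[of y t t'] x(2) unfolding Q_def Post_def by blast
  qed
  ultimately obtain f where f: "f 0 = z'" "\<And>i. Q (f i)" "\<And>i. steps S v (f i) (f (Suc i))"
    using dependent_nat_choice[of "\<lambda>i t. Q t \<and> (i = 0 \<longrightarrow> t = z')" "\<lambda>_ t t'. steps S v t t'"] by auto
  then show ?thesis unfolding rep_coverable_def
    using z'(1) v(1) by (intro exI[of _ f]) (auto simp: Q_def)
qed

text \<open>The wqo on states gives \<open>i < j\<close> with \<open>z i\<close> below
  \<open>z j\<close>; the word between them is \<open>v\<close>, nonempty because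
  \<open>i < j\<close>.\<close>

lemma rep_coverable_pump:
  assumes "y \<in> states S" "rep_coverable S x y"
  shows "\<exists>u v z. steps S u x z \<and> v \<noteq> [] \<and> ord S y z \<and> positive_for S v z"
proof -
  obtain z where z: "\<exists>w. steps S w x (z 0)" "\<And>i. \<exists>w. w \<noteq> [] \<and> steps S w (z i) (z (Suc i))"
    "\<And>i. ord S y (z i)" using assms unfolding rep_coverable_def by blast
  have "z i \<in> states S" for i using z(2)[of i] steps_wf by blast
  moreover have "wqo_ts S" using very unfolding very_wsts_def wsts_def by blast
  ultimately obtain i j where ij: "i < j" "ord S (z i) (z j)" unfolding wqo_ts_def by meson
  have "\<exists>w. steps S w x (z i)"
  proof (induction i)
    case (Suc i)
    then show ?case using z(2)[of i] steps_append by metis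
  qed (use z in blast)
  moreover have "\<exists>w. w \<noteq> [] \<and> steps S w (z i) (z j)" using ij(1)
  proof (induction j)
    case (Suc j)
    then show ?case using z(2)[of j] steps_append by (metis append_is_Nil_conv less_Suc_eq)
  qed simp
  ultimately show ?thesis using ij z(3) unfolding positive_for_def by blast
qed

text \<open>If an intermediate ideal were strictly below a member \<open>K\<close> of
  \<open>F\<close>, running the rest of \<open>v\<close> from \<open>K\<close> would by strictness
  end properly above \<open>I\<close>, against maximality.\<close>

lemma positive_loop_exact_path:
  assumes F: "closed_cover x F" and x: "x \<in> states S"
    and I: "I \<in> F" "\<forall>K\<in>F. \<not> I \<subset> K" and v: "wpost S v I = I"
  shows "exact_path S F I v"
proof -
  have R: "K \<in> F \<Longrightarrow> creach S x K \<and> K \<in> Idl S" for K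
    using F creach_Idl[OF x] unfolding closed_cover_def by blast
  \<comment> \<open>Every reachable ideal lies below a member of \<open>F\<close>, so maximality in
    \<open>F\<close> extends to all of them.\<close>
  have maximal: "\<not> I \<subset> J" if "creach S x J" for J
    using closed_cover_covers[OF F x that] I(2) unfolding covered_def by blast
  \<comment> \<open>Generalised to a suffix \<open>w\<close> and a member \<open>J\<close> of
    \<open>F\<close> from which it leads back to \<open>I\<close>.\<close>
  have "wpost S w J = I \<Longrightarrow> J \<in> F \<Longrightarrow> exact_path S F J w" for w J
  proof (induction w arbitrary: J)
    case (Cons a w)
    have J: "creach S x J" "J \<in> Idl S" using R Cons.prems by auto
    have ne: "wpost S [a] J \<noteq> {}" "wpost S w (wpost S [a] J) = I"
      using Cons.prems(1) wpost_Cons[OF J(2), of a w] Idl_nonempty[of I] R[OF I(1)] by auto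
    have J': "creach S x (wpost S [a] J)" "wpost S [a] J \<in> Idl S"
      using creach_wpost[OF x J(1) ne(1)] creach_Idl[OF x] by auto
    obtain K where K: "K \<in> F" "wpost S [a] J \<subseteq> K"
      using closed_cover_covers[OF F x J'(1)] unfolding covered_def by blast
    have "wpost S [a] J = K"
    proof (rule ccontr)
      assume "wpost S [a] J \<noteq> K"
      then have "I \<subset> wpost S w K"
        using wpost_strict[OF J'(2), of K w] K R[OF K(1)] ne(2) Idl_nonempty[of I] R[OF I(1)] by auto
      moreover from this have "creach S x (wpost S w K)" using creach_wpost[OF x] R[OF K(1)] by auto
      ultimately show False using maximal by blast
    qed
    then show ?case using Cons.IH K(1) ne J(2) by (intro exact_path_Cons) (auto simp: cstep_iff)
  qed (auto intro: exact_path_Nil)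
  then show ?thesis using I(1) v by blast
qed

text \<open>A positive word enabled at a maximal member of the cover cannot enlarge it, since its
  acceleration would escape the cover; by strictness no intermediate ideal can be enlarged either.\<close>

theorem rep_coverable_iff_exact_path:
  assumes pos: "positive_ts S" and F: "closed_cover x F" and x: "x \<in> states S" and y: "y \<in> states S"
  shows "rep_coverable S x y \<longleftrightarrow>
    (\<exists>I\<in>F. y \<in> I \<and> (\<exists>v. v \<noteq> [] \<and> positive_word S v \<and> exact_path S F I v))"
proof
  have R: "K \<in> F \<Longrightarrow> creach S x K \<and> K \<in> Idl S" for K
    using F creach_Idl[OF x] unfolding closed_cover_def by blast
  { assume "\<exists>I\<in>F. y \<in> I \<and> (\<exists>v. v \<noteq> [] \<and> positive_word S v \<and> exact_path S F I v)"
    then show "rep_coverable S x y"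
      using R rep_coverable_if_positive_enabled[OF x y] exact_path_wpost_nonempty by meson }
  assume "rep_coverable S x y"
  then obtain u v z where z: "steps S u x z" "v \<noteq> []" "ord S y z" "positive_for S v z"
    using rep_coverable_pump[OF y] by blast
  have zS: "z \<in> states S" using z(1) steps_wf by blast
  then have v: "positive_word S v" using pos z(4) unfolding positive_ts_def by blast
  have "z \<in> wpost S u (down S {x})"
    using z(1) zS ord_refl x by (auto simp: mem_wpost down_def)
  then obtain K where K: "K \<in> F" "z \<in> K"
    using closed_cover_covers[OF F x creach_wpost[OF x creach_init]] unfolding covered_def by blast
  have "finite {J \<in> F. K \<subseteq> J}" using F unfolding closed_cover_def by auto
  then obtain I where "I \<in> {J \<in> F. K \<subseteq> J}" "\<forall>J\<in>{J \<in> F. K \<subseteq> J}. I \<subseteq> J \<longrightarrow> I = J"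
    using finite_has_maximal[of "{J \<in> F. K \<subseteq> J}"] K by blast
  then have I: "I \<in> F" "z \<in> I" and maximal: "\<forall>J\<in>F. \<not> I \<subset> J" using K by blast+
  have Id: "I \<in> Idl S" using R I by blast
  have "y \<in> I" using I(2) z(3) y Id unfolding Idl_iff by blast
  obtain z1 where z1: "steps S v z z1" using z(4) unfolding positive_for_def by blast
  have "I \<subseteq> wpost S v I"
  proof
    fix t assume t: "t \<in> I"
    \<comment> \<open>Being above \<open>z\<close>, the state \<open>t'\<close> enables
      \<open>v\<close>; positivity brings the run back above \<open>t'\<close> and hence above
      \<open>t\<close>.\<close>
    obtain t' where t': "t' \<in> I" "ord S t t'" "ord S z t'" using Idl_directed[OF Id t I(2)] by blast
    have st: "t \<in> states S" "t' \<in> states S" using t t' Id Idl_iff by auto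
    then obtain t'' where "steps S v t' t''" using steps_mono[OF z1] t' by blast
    then obtain s where "steps S v t' s" "ord S t' s"
      using v st unfolding positive_word_def positive_for_def Post_def by blast
    then show "t \<in> wpost S v I" unfolding mem_wpost
      using st t' ord_trans[of t t' s] steps_wf by blast
  qed
  moreover have "\<not> I \<subset> wpost S v I"
  proof
    assume str: "I \<subset> wpost S v I"
    have "creach S x (winf S v I)" using creach_winf R I(1) z1 steps_wf by metis
    then obtain J where "J \<in> F" "winf S v I \<subseteq> J"
      using closed_cover_covers[OF F x] unfolding covered_def by blast
    then show False using maximal str wpost_subset_winf[OF Id str] by blast
  qed
  ultimately have "wpost S v I = I" by blast
  then have "exact_path S F I v" using positive_loop_exact_path[OF F x I(1) maximal] by blast
  then show "\<exists>I\<in>F. y \<in> I \<and> (\<exists>v. v \<noteq> [] \<and> positive_word S v \<and> exact_path S F I v)"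
    using I(1) \<open>y \<in> I\<close> z(2) v by blast
qed

end

section \<open>The cover automaton\<close>

definition triplec :: "nat \<Rightarrow> nat \<Rightarrow> nat \<Rightarrow> nat" where
  "triplec p a q = consc p (consc a (consc q 0))"

lemma triplec_eq: "triplec p a q = list_encode [p, a, q]"
  by (simp add: triplec_def consc_def)

lemma triplec_inject: "triplec p a q = triplec p' a' q' \<longleftrightarrow> p = p' \<and> a = a' \<and> q = q'"
  by (simp add: triplec_eq list_encode_eq)

lemma total_rec_triplec:
  "total_rec f \<Longrightarrow> total_rec g \<Longrightarrow> total_rec h \<Longrightarrow> total_rec (\<lambda>x. triplec (f x) (g x) (h x))"
  unfolding triplec_def by (intro total_rec_consc total_rec_const)

text \<open>The positivity test speaks of some automaton with the given code; injectivity identifies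
  that automaton.\<close>

lemma inj_nfa_code: "inj nfa_code"
proof (rule injI)
  fix A B assume eq: "nfa_code A = nfa_code B"
  obtain i t f i' t' f' where A: "A = (i, t, f)" and B: "B = (i', t', f')" by (metis prod_cases3)
  have "inj (\<lambda>(p, a, q). list_encode [p, a, q])" by (auto simp: inj_def list_encode_eq)
  then show "A = B" using eq unfolding A B nfa_code_def by (simp add: list_encode_eq inj_map_eq_map)
qed

text \<open>Names the programs behind the effectiveness assumptions, so that formulas can refer to
  their graphs.\<close>

locale effective_class =
  fixes sysOf :: "nat \<Rightarrow> 'x ts" and Codes :: "nat set"
    and stOf :: "nat \<Rightarrow> nat \<Rightarrow> 'x" and idlOf :: "nat \<Rightarrow> nat \<Rightarrow> 'x set"
    and palph pdown pincl psucc pinf ppos :: recf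
  assumes very: "s \<in> Codes \<Longrightarrow> very_wsts (sysOf s)"
    and positive: "s \<in> Codes \<Longrightarrow> positive_ts (sysOf s)"
    and palph: "computes_on palph {[s] | s. s \<in> Codes}
        (\<lambda>xs r. set (list_decode r) = alph (sysOf (xs ! 0)))"
    and pdown: "computes_on pdown {[s, m] | s m. s \<in> Codes \<and> stOf s m \<in> states (sysOf s)}
        (\<lambda>xs r. idlOf (xs ! 0) r = down (sysOf (xs ! 0)) {stOf (xs ! 0) (xs ! 1)})"
    and pincl: "decides_on pincl
        {[s, i, j] | s i j. s \<in> Codes \<and> idlOf s i \<in> Idl (sysOf s) \<and> idlOf s j \<in> Idl (sysOf s)}
        (\<lambda>xs. idlOf (xs ! 0) (xs ! 1) \<subseteq> idlOf (xs ! 0) (xs ! 2))"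
    and psucc: "computes_on psucc
        {[s, i, a] | s i a. s \<in> Codes \<and> idlOf s i \<in> Idl (sysOf s) \<and> a \<in> alph (sysOf s)}
        (\<lambda>xs r. idlOf (xs ! 0) ` set (list_decode r) =
          {J. cstep (sysOf (xs ! 0)) (xs ! 2) (idlOf (xs ! 0) (xs ! 1)) J})"
    and pinf: "computes_on pinf
        {[s, i, wc] | s i wc. s \<in> Codes \<and> idlOf s i \<in> Idl (sysOf s) \<and>
          set (list_decode wc) \<subseteq> alph (sysOf s)}
        (\<lambda>xs r. idlOf (xs ! 0) r =
          winf (sysOf (xs ! 0)) (list_decode (xs ! 2)) (idlOf (xs ! 0) (xs ! 1)))"
    and ppos: "decides_on ppos {[s, nfa_code A] | s A. s \<in> Codes \<and> nfa_over A (alph (sysOf s))}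
        (\<lambda>xs. \<exists>A. xs ! 1 = nfa_code A \<and> (\<exists>w\<in>nfa_lang A. positive_word (sysOf (xs ! 0)) w))"
begin

section \<open>Sigma_1 description of the cover automaton\<close>

definition derive_step :: "nat \<Rightarrow> nat \<Rightarrow> nat \<Rightarrow> nat \<Rightarrow> bool" where
  "derive_step s al i j \<longleftrightarrow>
     (\<exists>a\<in>set (list_decode al). \<exists>r. evalr psucc [s, i, a] r \<and> j \<in> set (list_decode r)) \<or>
     (\<exists>w. (\<forall>a\<in>set (list_decode w). a \<in> set (list_decode al)) \<and> evalr pinf [s, i, w] j)"

text \<open>An ideal may have several codes, so a computed successor is compared with the ideal of
  \<open>q\<close> by inclusion both ways.\<close>

definition edge :: "nat \<Rightarrow> nat \<Rightarrow> nat \<Rightarrow> nat \<Rightarrow> bool" where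
  "edge s i a q \<longleftrightarrow> (\<exists>r. evalr psucc [s, i, a] r \<and>
     (\<exists>k\<in>set (list_decode r). evalr pincl [s, k, q] 1 \<and> evalr pincl [s, q, k] 1))"

text \<open>A negated Sigma_1 formula need not be Sigma_1; the answer 0 of the inclusion program
  states the negation positively.\<close>

definition no_edge :: "nat \<Rightarrow> nat \<Rightarrow> nat \<Rightarrow> nat \<Rightarrow> bool" where
  "no_edge s i a q \<longleftrightarrow> (\<exists>r. evalr psucc [s, i, a] r \<and>
     (\<forall>k\<in>set (list_decode r). evalr pincl [s, k, q] 0 \<or> evalr pincl [s, q, k] 0))"

text \<open>\<open>c\<close> codes the automaton on a finite closed cover \<open>L\<close> whose transitions are the exact
  completion steps. The fresh initial state \<open>b\<close> copies the outgoing transitions of all ideals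
  containing the target state, so that only nonempty words are accepted.\<close>

definition cover_automaton :: "nat \<Rightarrow> nat \<Rightarrow> nat \<Rightarrow> nat \<Rightarrow> bool" where
  "cover_automaton s m n c \<longleftrightarrow> (\<exists>al d e L b tr.
     evalr palph [s] al \<and> evalr pdown [s, m] d \<and> evalr pdown [s, n] e \<and>
     (\<forall>i\<in>set (list_decode L). (derive_step s al)\<^sup>*\<^sup>* d i) \<and>
     (\<exists>i\<in>set (list_decode L). evalr pincl [s, d, i] 1) \<and>
     (\<forall>i\<in>set (list_decode L). \<forall>a\<in>set (list_decode al). \<exists>r. evalr psucc [s, i, a] r \<and>
        (\<forall>j\<in>set (list_decode r). \<exists>k\<in>set (list_decode L). evalr pincl [s, j, k] 1)) \<and>
     (\<forall>i\<in>set (list_decode L). i < b) \<and>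
     (\<forall>t\<in>set (list_decode tr). \<exists>a\<in>set (list_decode al). \<exists>q\<in>set (list_decode L).
        \<exists>i\<in>set (list_decode L). edge s i a q \<and>
          (t = triplec i a q \<or> (t = triplec b a q \<and> evalr pincl [s, e, i] 1))) \<and>
     (\<forall>a\<in>set (list_decode al). \<forall>q\<in>set (list_decode L). \<forall>i\<in>set (list_decode L).
        no_edge s i a q \<or> (triplec i a q \<in> set (list_decode tr) \<and>
          (evalr pincl [s, e, i] 0 \<or> triplec b a q \<in> set (list_decode tr)))) \<and>
     c = triplec (consc b 0) tr L)"

lemma re_cover_automaton:
  assumes "total_rec fs" "total_rec fm" "total_rec fn" "total_rec fc"
  shows "re (\<lambda>z. cover_automaton (fs z) (fm z) (fn z) (fc z))"
  unfolding cover_automaton_def derive_step_def edge_def no_edge_def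
  by (intro re_intros re_bex_list re_ball_list re_in_list re_rtranclp re_evalr1 re_evalr2 re_evalr3
      total_rec_intros total_rec_triplec total_rec_consc
      total_rec_comp[OF assms(1)] total_rec_comp[OF assms(2)]
      total_rec_comp[OF assms(3)] total_rec_comp[OF assms(4)])

section \<open>Correctness of the coding for a single system\<close>

context
  fixes s :: nat
  assumes s: "s \<in> Codes"
begin

abbreviation "S \<equiv> sysOf s"
abbreviation "J \<equiv> idlOf s"

interpretation vwsts S
  by unfold_locales (rule very[OF s])

lemma palph_total: "\<exists>r. evalr palph [s] r"
  and palph_sound: "evalr palph [s] r \<Longrightarrow> set (list_decode r) = alph S"
  using palph s unfolding computes_on_def by auto

lemma pdown_total: "stOf s m \<in> states S \<Longrightarrow> \<exists>r. evalr pdown [s, m] r"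
  and pdown_sound: "stOf s m \<in> states S \<Longrightarrow> evalr pdown [s, m] r \<Longrightarrow> J r = down S {stOf s m}"
  using bspec[OF pdown[unfolded computes_on_def], of "[s, m]"] s by auto

lemma pincl_1_iff: "J i \<in> Idl S \<Longrightarrow> J j \<in> Idl S \<Longrightarrow> evalr pincl [s, i, j] 1 \<longleftrightarrow> J i \<subseteq> J j"
  and pincl_0_iff: "J i \<in> Idl S \<Longrightarrow> J j \<in> Idl S \<Longrightarrow> evalr pincl [s, i, j] 0 \<longleftrightarrow> \<not> J i \<subseteq> J j"
proof -
  assume ij: "J i \<in> Idl S" "J j \<in> Idl S"
  have "(\<exists>r. evalr pincl [s, i, j] r) \<and> (\<forall>r. evalr pincl [s, i, j] r \<longrightarrow> r = (if J i \<subseteq> J j then 1 else 0))"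
    using bspec[OF pincl[unfolded decides_on_def computes_on_def], of "[s, i, j]"] s ij by simp
  then show "evalr pincl [s, i, j] 1 \<longleftrightarrow> J i \<subseteq> J j" "evalr pincl [s, i, j] 0 \<longleftrightarrow> \<not> J i \<subseteq> J j"
    by (auto split: if_splits)
qed

lemma psucc_total: "J i \<in> Idl S \<Longrightarrow> a \<in> alph S \<Longrightarrow> \<exists>r. evalr psucc [s, i, a] r"
  and psucc_sound: "J i \<in> Idl S \<Longrightarrow> a \<in> alph S \<Longrightarrow> evalr psucc [s, i, a] r \<Longrightarrow>
    J ` set (list_decode r) = {K. cstep S a (J i) K}"
  using bspec[OF psucc[unfolded computes_on_def], of "[s, i, a]"] s by auto

lemma pinf_total: "J i \<in> Idl S \<Longrightarrow> set (list_decode w) \<subseteq> alph S \<Longrightarrow> \<exists>r. evalr pinf [s, i, w] r"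
  and pinf_sound: "J i \<in> Idl S \<Longrightarrow> set (list_decode w) \<subseteq> alph S \<Longrightarrow> evalr pinf [s, i, w] r \<Longrightarrow>
    J r = winf S (list_decode w) (J i)"
  using bspec[OF pinf[unfolded computes_on_def], of "[s, i, w]"] s by auto

lemma edge_iff:
  assumes "J i \<in> Idl S" "J q \<in> Idl S" "a \<in> alph S"
  shows "edge s i a q \<longleftrightarrow> cstep S a (J i) (J q)"
    and "no_edge s i a q \<longleftrightarrow> \<not> cstep S a (J i) (J q)"
proof -
  have *: "(\<exists>k\<in>set (list_decode r). evalr pincl [s, k, q] 1 \<and> evalr pincl [s, q, k] 1) \<longleftrightarrow>
      cstep S a (J i) (J q)"
    "(\<forall>k\<in>set (list_decode r). evalr pincl [s, k, q] 0 \<or> evalr pincl [s, q, k] 0) \<longleftrightarrow>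
      \<not> cstep S a (J i) (J q)"
    if r: "evalr psucc [s, i, a] r" for r
  proof -
    have im: "J ` set (list_decode r) = {K. cstep S a (J i) K}" using psucc_sound assms r by blast
    have id: "J k \<in> Idl S" if "k \<in> set (list_decode r)" for k
      using im that cstep_Idl by blast
    have c: "cstep S a (J i) (J q) \<longleftrightarrow> (\<exists>k\<in>set (list_decode r). J k = J q)"
      using im by (metis imageE imageI mem_Collect_eq)
    show "(\<exists>k\<in>set (list_decode r). evalr pincl [s, k, q] 1 \<and> evalr pincl [s, q, k] 1) \<longleftrightarrow>
      cstep S a (J i) (J q)"
      unfolding c using pincl_1_iff[OF id assms(2)] pincl_1_iff[OF assms(2) id] by blast
    show "(\<forall>k\<in>set (list_decode r). evalr pincl [s, k, q] 0 \<or> evalr pincl [s, q, k] 0) \<longleftrightarrow>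
      \<not> cstep S a (J i) (J q)"
      unfolding c using pincl_0_iff[OF id assms(2)] pincl_0_iff[OF assms(2) id] by blast
  qed
  obtain r where r: "evalr psucc [s, i, a] r" using psucc_total[OF assms(1,3)] by blast
  show "edge s i a q \<longleftrightarrow> cstep S a (J i) (J q)" "no_edge s i a q \<longleftrightarrow> \<not> cstep S a (J i) (J q)"
    unfolding edge_def no_edge_def using r *(1)[of r] *(2)[of r] *(1) *(2) by meson+
qed

text \<open>By induction every derived code denotes a reachable ideal, so the programs are consulted
  only inside their domains.\<close>

lemma derive_step_sound:
  assumes "set (list_decode al) = alph S" "x \<in> states S" "J d = down S {x}" "(derive_step s al)\<^sup>*\<^sup>* d i"
  shows "creach S x (J i)"
  using assms(4)
proof (induction rule: rtranclp_induct)
  case base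
  then show ?case using assms(3) creach_init by metis
next
  case (step i j)
  have i: "J i \<in> Idl S" using step creach_Idl[OF assms(2)] by blast
  from step(2) consider
    a r where "a \<in> alph S" "evalr psucc [s, i, a] r" "j \<in> set (list_decode r)"
    | w where "set (list_decode w) \<subseteq> alph S" "evalr pinf [s, i, w] j"
    unfolding derive_step_def assms(1) by blast
  then show ?case
  proof cases
    case 1
    then have "cstep S a (J i) (J j)" using psucc_sound[OF i] by blast
    then show ?thesis using step creach_step by metis
  next
    case 2
    then show ?thesis using pinf_sound[OF i] step creach_winf by metis
  qed
qed

text \<open>The programs choose the codes, so the claim is only that each reachable ideal receives
  some derivable code.\<close>

lemma derive_step_complete:
  assumes "set (list_decode al) = alph S" "x \<in> states S" "J d = down S {x}" "creach S x K"
  shows "\<exists>i. (derive_step s al)\<^sup>*\<^sup>* d i \<and> J i = K"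
  using assms(4)
proof (induction rule: creach.induct)
  case creach_init
  then show ?case using assms(3) by blast
next
  case (creach_step I a K)
  then obtain i where i: "(derive_step s al)\<^sup>*\<^sup>* d i" "J i = I" by blast
  have a: "a \<in> alph S" "J i \<in> Idl S" using creach_step(2) i unfolding cstep_def by auto
  then obtain r where r: "evalr psucc [s, i, a] r" using psucc_total by blast
  then have "K \<in> J ` set (list_decode r)" using psucc_sound[OF a(2,1) r] creach_step(2) i by simp
  then obtain j where "j \<in> set (list_decode r)" "J j = K" by blast
  moreover from this have "derive_step s al i j" unfolding derive_step_def assms(1) using a r by blast
  ultimately show ?case using i(1) rtranclp.rtrancl_into_rtrancl by metis
next
  case (creach_winf I w)
  then obtain i where i: "(derive_step s al)\<^sup>*\<^sup>* d i" "J i = I" by blast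
  have I: "J i \<in> Idl S" using creach_Idl[OF assms(2) creach_winf(1)] i by simp
  have w: "set (list_decode (list_encode w)) \<subseteq> alph S" using creach_winf by simp
  then obtain r where r: "evalr pinf [s, i, list_encode w] r" using pinf_total[OF I] by blast
  then have "J r = winf S w I" using pinf_sound[OF I w r] i by simp
  moreover have "derive_step s al i r" unfolding derive_step_def assms(1) using w r by blast
  ultimately show ?case using i(1) rtranclp.rtrancl_into_rtrancl by metis
qed

section \<open>Existence and correctness of the automaton\<close>

lemma cover_automaton_exists:
  assumes m: "stOf s m \<in> states S" and n: "stOf s n \<in> states S"
  shows "\<exists>c. cover_automaton s m n c"
proof -
  let ?x = "stOf s m" and ?y = "stOf s n"
  obtain al d e where o: "evalr palph [s] al" "evalr pdown [s, m] d" "evalr pdown [s, n] e"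
    using palph_total pdown_total m n by blast
  have al: "set (list_decode al) = alph S" using palph_sound o by blast
  have d: "J d = down S {?x}" and e: "J e = down S {?y}" using pdown_sound m n o by auto
  have de: "J d \<in> Idl S" "J e \<in> Idl S" using d e down_single_Idl m n by auto
  obtain F where F: "closed_cover ?x F" using closed_cover_exists m by blast
  have "\<forall>K\<in>F. \<exists>i. (derive_step s al)\<^sup>*\<^sup>* d i \<and> J i = K"
    using derive_step_complete[OF al m d] F unfolding closed_cover_def by blast
  then obtain code where code: "\<And>K. K \<in> F \<Longrightarrow> (derive_step s al)\<^sup>*\<^sup>* d (code K) \<and> J (code K) = K"
    by metis
  have "finite (code ` F)" using F unfolding closed_cover_def by blast
  then obtain Ls where Ls: "set Ls = code ` F" using finite_list[of "code ` F"] by auto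
  \<comment> \<open>A state number above all chosen codes; inserting 0 keeps \<open>Max\<close>
    meaningful without a nonemptiness argument.\<close>
  define b where "b = Suc (Max (insert 0 (set Ls)))"
  have b: "\<forall>i\<in>set Ls. i < b" unfolding b_def by (simp add: less_Suc_eq_le)
  have LF: "J i \<in> F" "(derive_step s al)\<^sup>*\<^sup>* d i" if "i \<in> set Ls" for i
    using that Ls code by auto
  have FL: "\<exists>i\<in>set Ls. J i = K" if "K \<in> F" for K using that Ls code by auto
  have Id: "J i \<in> Idl S" if "i \<in> set Ls" for i
    using LF(1)[OF that] F creach_Idl[OF m] unfolding closed_cover_def by blast
  have cov: "\<exists>k\<in>set Ls. evalr pincl [s, j, k] 1" if "covered F (J j)" "J j \<in> Idl S" for j
    using that FL pincl_1_iff[OF that(2) Id] unfolding covered_def by metis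
  \<comment> \<open>All transitions that the automaton may have; they are finitely many, as their
    components come from finite sets.\<close>
  define good where "good t \<longleftrightarrow> (\<exists>a\<in>alph S. \<exists>q\<in>set Ls. \<exists>i\<in>set Ls. edge s i a q \<and>
      (t = triplec i a q \<or> (t = triplec b a q \<and> evalr pincl [s, e, i] 1)))" for t
  have "{t. good t} \<subseteq> (\<lambda>(i, a, q). triplec i a q) ` (insert b (set Ls) \<times> alph S \<times> set Ls)"
    unfolding good_def by force
  then have "finite {t. good t}" using finite_alph by (meson List.finite_set finite_SigmaI finite_imageI finite_insert finite_subset)
  then obtain trs where trs: "set trs = {t. good t}" using finite_list[of "{t. good t}"] by auto
  have init: "\<exists>i\<in>set Ls. evalr pincl [s, d, i] 1"
    using cov de(1) d F unfolding closed_cover_def by simp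
  have closed: "\<exists>r. evalr psucc [s, i, a] r \<and> (\<forall>j\<in>set (list_decode r). \<exists>k\<in>set Ls. evalr pincl [s, j, k] 1)"
    if i: "i \<in> set Ls" "a \<in> alph S" for i a
  proof -
    obtain r where r: "evalr psucc [s, i, a] r" using psucc_total Id i by blast
    have "\<exists>k\<in>set Ls. evalr pincl [s, j, k] 1" if "j \<in> set (list_decode r)" for j
    proof (rule cov)
      have cs: "cstep S a (J i) (J j)" using psucc_sound[OF Id[OF i(1)] i(2) r] that by blast
      then show "J j \<in> Idl S" using cstep_Idl by blast
      have "J j = wpost S [a] (J i)" "J j \<noteq> {}" using cs unfolding cstep_iff by blast+
      then show "covered F (J j)" using F LF(1)[OF i(1)] unfolding closed_cover_def by metis
    qed
    then show ?thesis using r by blast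
  qed
  have complete: "no_edge s i a q \<or> (triplec i a q \<in> set trs \<and>
      (evalr pincl [s, e, i] 0 \<or> triplec b a q \<in> set trs))"
    if "a \<in> alph S" "q \<in> set Ls" "i \<in> set Ls" for a q i
    using that edge_iff[OF Id Id, of i q a] pincl_0_iff[OF de(2) Id, of i] pincl_1_iff[OF de(2) Id, of i]
    unfolding trs mem_Collect_eq good_def by blast
  have "cover_automaton s m n (triplec (consc b 0) (list_encode trs) (list_encode Ls))"
    unfolding cover_automaton_def
    by (rule exI[of _ al], rule exI[of _ d], rule exI[of _ e], rule exI[of _ "list_encode Ls"],
        rule exI[of _ b], rule exI[of _ "list_encode trs"], unfold list_encode_inverse al trs)
      (intro conjI o init b refl ballI LF(2) closed complete[unfolded trs],
        assumption+, simp add: good_def, assumption+)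
  then show ?thesis by blast
qed

text \<open>Stated for every \<open>c\<close> satisfying the formula, because the search may find
  any of them.\<close>

lemma cover_automaton_correct:
  assumes m: "stOf s m \<in> states S" and n: "stOf s n \<in> states S" and c: "cover_automaton s m n c"
  shows "\<exists>A. c = nfa_code A \<and> nfa_over A (alph S) \<and>
    ((\<exists>w\<in>nfa_lang A. positive_word S w) \<longleftrightarrow> rep_coverable S (stOf s m) (stOf s n))"
proof -
  let ?x = "stOf s m" and ?y = "stOf s n"
  obtain al d e L b tr where o: "evalr palph [s] al" "evalr pdown [s, m] d" "evalr pdown [s, n] e"
    and der: "\<forall>i\<in>set (list_decode L). (derive_step s al)\<^sup>*\<^sup>* d i"
    and init: "\<exists>i\<in>set (list_decode L). evalr pincl [s, d, i] 1"
    and cl: "\<forall>i\<in>set (list_decode L). \<forall>a\<in>set (list_decode al). \<exists>r. evalr psucc [s, i, a] r \<and>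
        (\<forall>j\<in>set (list_decode r). \<exists>k\<in>set (list_decode L). evalr pincl [s, j, k] 1)"
    and b: "\<forall>i\<in>set (list_decode L). i < b"
    and tr1: "\<forall>t\<in>set (list_decode tr). \<exists>a\<in>set (list_decode al). \<exists>q\<in>set (list_decode L).
        \<exists>i\<in>set (list_decode L). edge s i a q \<and>
          (t = triplec i a q \<or> (t = triplec b a q \<and> evalr pincl [s, e, i] 1))"
    and tr2: "\<forall>a\<in>set (list_decode al). \<forall>q\<in>set (list_decode L). \<forall>i\<in>set (list_decode L).
        no_edge s i a q \<or> (triplec i a q \<in> set (list_decode tr) \<and>
          (evalr pincl [s, e, i] 0 \<or> triplec b a q \<in> set (list_decode tr)))"
    and c: "c = triplec (consc b 0) tr L"
    using c unfolding cover_automaton_def by blast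
  have al: "set (list_decode al) = alph S" using palph_sound o by blast
  have d: "J d = down S {?x}" and e: "J e = down S {?y}" using pdown_sound m n o by auto
  have de: "J d \<in> Idl S" "J e \<in> Idl S" using d e down_single_Idl m n by auto
  define Ls where "Ls = set (list_decode L)"
  have R: "creach S ?x (J i)" "J i \<in> Idl S" if "i \<in> Ls" for i
    using derive_step_sound[OF al m d] der that creach_Idl[OF m] unfolding Ls_def by blast+
  have in_iff: "evalr pincl [s, e, i] 1 \<longleftrightarrow> ?y \<in> J i" "evalr pincl [s, e, i] 0 \<longleftrightarrow> ?y \<notin> J i"
    if i: "i \<in> Ls" for i
  proof -
    \<comment> \<open>\<open>J e\<close> is the principal ideal of the target, so including it
      amounts to containing the target.\<close>
    have "J e \<subseteq> J i \<longleftrightarrow> ?y \<in> J i"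
      using Idl_down[OF R(2)[OF i]] ord_refl[OF n] n unfolding e down_def by blast
    then show "evalr pincl [s, e, i] 1 \<longleftrightarrow> ?y \<in> J i" "evalr pincl [s, e, i] 0 \<longleftrightarrow> ?y \<notin> J i"
      using pincl_1_iff pincl_0_iff de(2) R(2)[OF i] by auto
  qed
  have F: "closed_cover ?x (J ` Ls)" unfolding closed_cover_def
  proof (intro conjI ballI allI impI)
    show "covered (J ` Ls) (down S {?x})"
      using init pincl_1_iff[OF de(1)] R(2) d unfolding covered_def Ls_def by blast
    fix K a assume K: "K \<in> J ` Ls" "wpost S [a] K \<noteq> {}"
    then obtain i where i: "i \<in> Ls" "K = J i" by blast
    have cs: "cstep S a (J i) (wpost S [a] K)" using cstep_iff R(2) i K(2) by blast
    then have a: "a \<in> alph S" unfolding cstep_def by blast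
    obtain r where r: "evalr psucc [s, i, a] r"
      "\<forall>j\<in>set (list_decode r). \<exists>k\<in>set (list_decode L). evalr pincl [s, j, k] 1"
      using cl i(1) a unfolding al Ls_def by blast
    have "wpost S [a] K \<in> J ` set (list_decode r)"
      unfolding psucc_sound[OF R(2)[OF i(1)] a r(1)] using cs by simp
    then obtain j where j: "j \<in> set (list_decode r)" "J j = wpost S [a] K" by auto
    then obtain k where "k \<in> Ls" "evalr pincl [s, j, k] 1" using r(2) unfolding Ls_def by blast
    moreover have "J j \<in> Idl S" using cs cstep_Idl j(2) by metis
    ultimately show "covered (J ` Ls) (wpost S [a] K)"
      using pincl_1_iff R(2) j(2) unfolding covered_def by auto
  qed (use R in \<open>auto simp: Ls_def\<close>)
  define enc :: "nat \<times> nat \<times> nat \<Rightarrow> nat" where "enc = (\<lambda>(p, a, q). list_encode [p, a, q])"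
  have enc: "enc (p, a, q) = triplec p a q" for p a q
    unfolding enc_def triplec_eq by simp
  have "inj enc" unfolding inj_def by (auto simp: enc triplec_inject)
  \<comment> \<open>All entries of \<open>tr\<close> code triples, so \<open>tr\<close> is the code
    of a genuine transition list.\<close>
  have "\<forall>t\<in>set (list_decode tr). \<exists>u. t = enc u"
  proof
    fix t assume "t \<in> set (list_decode tr)"
    then obtain p a q where "t = triplec p a q" using tr1 by blast
    then show "\<exists>u. t = enc u" using enc by metis
  qed
  then obtain trs where trs: "list_decode tr = map enc trs" unfolding ex_map_conv[symmetric] by blast
  have mem: "(p, a, q) \<in> set trs \<longleftrightarrow> triplec p a q \<in> set (list_decode tr)" for p a q
    unfolding trs set_map enc[symmetric] using inj_image_mem_iff[OF \<open>inj enc\<close>] by metis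
  \<comment> \<open>Freshness of \<open>b\<close> separates its transitions from those between
    ideals.\<close>
  have bL: "b \<notin> Ls" using b unfolding Ls_def by blast
  have inner: "(p, a, q) \<in> set trs \<longleftrightarrow> q \<in> Ls \<and> cstep S a (J p) (J q)" if p: "p \<in> Ls" for p a q
  proof
    assume "(p, a, q) \<in> set trs"
    then obtain a' q' i where "a' \<in> alph S" "q' \<in> Ls" "i \<in> Ls" "edge s i a' q'"
      "triplec p a q = triplec i a' q' \<or> triplec p a q = triplec b a' q'"
      using tr1 unfolding mem al Ls_def by blast
    then show "q \<in> Ls \<and> cstep S a (J p) (J q)"
      using p bL edge_iff(1)[OF R(2) R(2)] unfolding triplec_inject by metis
  next
    assume q: "q \<in> Ls \<and> cstep S a (J p) (J q)"
    then have "a \<in> alph S" unfolding cstep_def by blast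
    then show "(p, a, q) \<in> set trs"
      using tr2 edge_iff(2)[OF R(2) R(2)] p q unfolding mem al Ls_def by blast
  qed
  have outer: "(b, a, q) \<in> set trs \<longleftrightarrow> q \<in> Ls \<and> (\<exists>i\<in>Ls. ?y \<in> J i \<and> cstep S a (J i) (J q))" for a q
  proof
    assume "(b, a, q) \<in> set trs"
    then obtain a' q' i where "a' \<in> alph S" "q' \<in> Ls" "i \<in> Ls" "edge s i a' q'"
      "triplec b a q = triplec i a' q' \<or> (triplec b a q = triplec b a' q' \<and> evalr pincl [s, e, i] 1)"
      using tr1 unfolding mem al Ls_def by blast
    then show "q \<in> Ls \<and> (\<exists>i\<in>Ls. ?y \<in> J i \<and> cstep S a (J i) (J q))"
      using bL edge_iff(1)[OF R(2) R(2)] in_iff(1) unfolding triplec_inject by metis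
  next
    assume "q \<in> Ls \<and> (\<exists>i\<in>Ls. ?y \<in> J i \<and> cstep S a (J i) (J q))"
    then obtain i where i: "q \<in> Ls" "i \<in> Ls" "?y \<in> J i" "cstep S a (J i) (J q)" by blast
    then have a: "a \<in> alph S" unfolding cstep_def by blast
    have "\<not> no_edge s i a q" using edge_iff(2)[OF R(2) R(2)] i a by blast
    moreover have "\<not> evalr pincl [s, e, i] 0" using in_iff(2) i by blast
    ultimately show "(b, a, q) \<in> set trs" using tr2 i a unfolding mem al Ls_def by blast
  qed
  \<comment> \<open>All members of \<open>Ls\<close> are final states, so accepting runs from an
    ideal correspond to exact paths.\<close>
  have run1: "q \<in> Ls \<and> exact_path S (J ` Ls) (J p) v" if "nfa_run trs p v q" "p \<in> Ls" for p v q
    using that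
  proof (induction rule: nfa_run.induct)
    case (1 q)
    then show ?case by (auto intro: exact_path_Nil)
  next
    case (2 p a p' w q)
    then show ?case using inner by (auto intro: exact_path_Cons)
  qed
  have run2: "\<exists>q\<in>Ls. nfa_run trs p v q" if "exact_path S (J ` Ls) (J p) v" "p \<in> Ls" for p v
    using that
  proof (induction v arbitrary: p rule: list.induct)
    case Nil
    then show ?case using nfa_run.intros(1) by blast
  next
    case (Cons a v)
    from Cons.prems(1) obtain q where "q \<in> Ls" "cstep S a (J p) (J q)" "exact_path S (J ` Ls) (J q) v"
      unfolding exact_path_Cons_iff by auto
    then show ?case using Cons.IH Cons.prems(2) inner nfa_run.intros(2) by blast
  qed
  define A where "A = ([b], trs, list_decode L)"
  \<comment> \<open>The first letter leaves \<open>b\<close> on behalf of some ideal containing the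
    target; since \<open>b\<close> is not final, the empty word is rejected.\<close>
  have lang: "w \<in> nfa_lang A \<longleftrightarrow> w \<noteq> [] \<and> (\<exists>i\<in>Ls. ?y \<in> J i \<and> exact_path S (J ` Ls) (J i) w)" for w
  proof
    assume "w \<in> nfa_lang A"
    then obtain q where q: "q \<in> Ls" "nfa_run trs b w q" unfolding nfa_lang_def A_def Ls_def by auto
    from q(2) show "w \<noteq> [] \<and> (\<exists>i\<in>Ls. ?y \<in> J i \<and> exact_path S (J ` Ls) (J i) w)"
    proof cases
      case 1
      then show ?thesis using bL q(1) by blast
    next
      case (2 a q' v)
      then obtain i where "q' \<in> Ls" "i \<in> Ls" "?y \<in> J i" "cstep S a (J i) (J q')" using outer by blast
      moreover from this have "exact_path S (J ` Ls) (J q') v" using run1 2 by blast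
      ultimately show ?thesis using 2 exact_path_Cons by blast
    qed
  next
    assume "w \<noteq> [] \<and> (\<exists>i\<in>Ls. ?y \<in> J i \<and> exact_path S (J ` Ls) (J i) w)"
    then obtain i a v where i: "w = a # v" "i \<in> Ls" "?y \<in> J i" "exact_path S (J ` Ls) (J i) (a # v)"
      by (metis neq_Nil_conv)
    from i(4) obtain q where q: "q \<in> Ls" "cstep S a (J i) (J q)" "exact_path S (J ` Ls) (J q) v"
      unfolding exact_path_Cons_iff by auto
    then have "(b, a, q) \<in> set trs" using outer i by blast
    moreover obtain q' where "q' \<in> Ls" "nfa_run trs q v q'" using run2 q by blast
    ultimately have "nfa_run trs b w q'" unfolding i(1) using nfa_run.intros(2) by blast
    then show "w \<in> nfa_lang A" using \<open>q' \<in> Ls\<close> unfolding nfa_lang_def A_def Ls_def by auto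
  qed
  have "tr = list_encode (map enc trs)" using trs by (metis list_decode_inverse)
  then have "c = nfa_code A"
    unfolding c A_def nfa_code_def enc_def by (simp add: triplec_eq consc_def)
  moreover have "nfa_over A (alph S)"
  proof -
    have "a \<in> alph S" if "(p, a, q) \<in> set trs" for p a q
    proof -
      have "triplec p a q \<in> set (list_decode tr)" using that mem by blast
      then obtain a' q' p' where "a' \<in> alph S" "triplec p a q = triplec p' a' q'"
        using tr1 unfolding al by blast
      then show ?thesis unfolding triplec_inject by simp
    qed
    then have "case u of (p, a, q) \<Rightarrow> a \<in> alph S" if "u \<in> set trs" for u
      using that by (cases u) simp
    then show ?thesis unfolding nfa_over_def A_def by simp
  qed
  moreover have "(\<exists>w\<in>nfa_lang A. positive_word S w) \<longleftrightarrow> rep_coverable S ?x ?y"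
  proof -
    have "(\<exists>w\<in>nfa_lang A. positive_word S w) \<longleftrightarrow> (\<exists>w. w \<noteq> [] \<and> positive_word S w \<and>
        (\<exists>i\<in>Ls. ?y \<in> J i \<and> exact_path S (J ` Ls) (J i) w))"
      unfolding Bex_def[of "nfa_lang A"] lang by metis
    also have "\<dots> \<longleftrightarrow> (\<exists>i\<in>Ls. ?y \<in> J i \<and>
        (\<exists>w. w \<noteq> [] \<and> positive_word S w \<and> exact_path S (J ` Ls) (J i) w))" by metis
    finally show ?thesis
      unfolding rep_coverable_iff_exact_path[OF positive[OF s] F m n] bex_simps(7) .
  qed
  ultimately show ?thesis by blast
qed

text \<open>Some \<open>c\<close> exists and all of them lead to the same answer, so the two
  existential formulas are complementary on valid inputs.\<close>

lemma ppos_cover_automaton: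
  assumes "stOf s m \<in> states S" "stOf s n \<in> states S"
  shows "(\<exists>c. cover_automaton s m n c \<and> evalr ppos [s, c] 1) \<longleftrightarrow> rep_coverable S (stOf s m) (stOf s n)"
    and "(\<exists>c. cover_automaton s m n c \<and> evalr ppos [s, c] 0) \<longleftrightarrow> \<not> rep_coverable S (stOf s m) (stOf s n)"
proof -
  let ?rc = "rep_coverable S (stOf s m) (stOf s n)"
  have *: "(\<exists>r. evalr ppos [s, c] r) \<and> (\<forall>r. evalr ppos [s, c] r \<longrightarrow> r = (if ?rc then 1 else 0))"
    if c: "cover_automaton s m n c" for c
  proof -
    obtain A where A: "c = nfa_code A" "nfa_over A (alph S)"
      "(\<exists>w\<in>nfa_lang A. positive_word S w) \<longleftrightarrow> ?rc"
      using cover_automaton_correct[OF assms c] by blast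
    have "(\<exists>B. c = nfa_code B \<and> (\<exists>w\<in>nfa_lang B. positive_word S w)) \<longleftrightarrow> ?rc"
      using A(1,3) inj_nfa_code by (metis injD)
    moreover have "[s, c] \<in> {[s, nfa_code A] | s A. s \<in> Codes \<and> nfa_over A (alph (sysOf s))}"
      using A s by blast
    ultimately show ?thesis
      using bspec[OF ppos[unfolded decides_on_def computes_on_def], of "[s, c]"] by simp
  qed
  obtain c where c: "cover_automaton s m n c" using cover_automaton_exists assms by blast
  show "(\<exists>c. cover_automaton s m n c \<and> evalr ppos [s, c] 1) \<longleftrightarrow> ?rc"
    "(\<exists>c. cover_automaton s m n c \<and> evalr ppos [s, c] 0) \<longleftrightarrow> \<not> ?rc"
    using * c by (metis zero_neq_one)+
qed

end

section \<open>The decision procedure\<close>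

lemma rep_coverable_decidable:
  "\<exists>p. decides_on p
     {[s, m, n] | s m n. s \<in> Codes \<and> stOf s m \<in> states (sysOf s) \<and> stOf s n \<in> states (sysOf s)}
     (\<lambda>xs. rep_coverable (sysOf (xs ! 0)) (stOf (xs ! 0) (xs ! 1)) (stOf (xs ! 0) (xs ! 2)))"
proof (rule decides_on_triples_if_re)
  show "re (\<lambda>z. \<exists>c. cover_automaton (pfst z) (pfst (psnd z)) (psnd (psnd z)) c \<and> evalr ppos [pfst z, c] 1)"
    "re (\<lambda>z. \<exists>c. cover_automaton (pfst z) (pfst (psnd z)) (psnd (psnd z)) c \<and> evalr ppos [pfst z, c] 0)"
    by (intro re_ex re_conj re_cover_automaton re_evalr2 total_rec_intros)+
  fix xs
  assume "xs \<in> {[s, m, n] | s m n. s \<in> Codes \<and> stOf s m \<in> states (sysOf s) \<and> stOf s n \<in> states (sysOf s)}"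
  then obtain s m n where xs: "xs = [s, m, n]"
    and smn: "s \<in> Codes" "stOf s m \<in> states (sysOf s)" "stOf s n \<in> states (sysOf s)" by blast
  show "\<exists>s m n. xs = [s, m, n] \<and>
    ((\<exists>c. cover_automaton s m n c \<and> evalr ppos [s, c] 1) \<longleftrightarrow>
      rep_coverable (sysOf (xs ! 0)) (stOf (xs ! 0) (xs ! 1)) (stOf (xs ! 0) (xs ! 2))) \<and>
    ((\<exists>c. cover_automaton s m n c \<and> evalr ppos [s, c] 0) \<longleftrightarrow>
      \<not> rep_coverable (sysOf (xs ! 0)) (stOf (xs ! 0) (xs ! 1)) (stOf (xs ! 0) (xs ! 2)))"
    using ppos_cover_automaton[OF smn] xs by auto
qed

end

theorem theorem18:
  fixes sysOf :: "nat \<Rightarrow> 'x ts" and Codes :: "nat set"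
    and stOf :: "nat \<Rightarrow> nat \<Rightarrow> 'x" and idlOf :: "nat \<Rightarrow> nat \<Rightarrow> 'x set"
  assumes members: "\<forall>s\<in>Codes. very_wsts (sysOf s) \<and> positive_ts (sysOf s)"
    and states_rep: "\<forall>s\<in>Codes. states (sysOf s) \<subseteq> range (stOf s)"
    and "completion_post_effective sysOf Codes stOf idlOf"
    and "inf_completion_effective sysOf Codes idlOf"
    and "positive_effective sysOf Codes"
  shows "\<exists>p. decides_on p
           {[s, m, n] | s m n. s \<in> Codes \<and> stOf s m \<in> states (sysOf s) \<and> stOf s n \<in> states (sysOf s)}
           (\<lambda>xs. rep_coverable (sysOf (xs ! 0)) (stOf (xs ! 0) (xs ! 1)) (stOf (xs ! 0) (xs ! 2)))"
proof -
  obtain palph pdown pincl psucc pinf ppos where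
    "effective_class sysOf Codes stOf idlOf palph pdown pincl psucc pinf ppos"
    using assms unfolding completion_post_effective_def inf_completion_effective_def
      positive_effective_def effective_class_def by (elim conjE exE) blast
  then show ?thesis by (rule effective_class.rep_coverable_decidable)
qed

end
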